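(* (i) For $A,B\subseteq\mathbb{N}$, if $\tilde{\mathbf{c}}_A \geq [B]_{\mathrm{T0}}$ (in the T3 degrees), then one of $A,B$ is computable. In other words: for all Turing degrees $\mathbf{a},\mathbf{b}$, if $\operatorname{coT}(\mathbf{a}) \geq \mathbf{b}$ then $\mathbf{a}=\mathbf{0}$ or $\mathbf{b}=\mathbf{0}$ (and the converse also holds). (ii) For $A,B\subseteq\mathbb{N}$, it is never true that $\tilde{\mathbf{c}}_A \leq [B]_{\mathrm{T0}}$. In other words: for all Turing degrees $\mathbf{a},\mathbf{b}$, we have $\operatorname{coT}(\mathbf{a}) \not\leq \mathbf{b}$.
   Context: Oracles. A T0 oracle is a total function $\mathbb{N}\to\mathbb{N}$; a T1 oracle is a partial function from $\mathbb{N}$ to $\mathbb{N}$; a T2 oracle is a partial function from $\mathbb{N}$ to $\mathcal{P}(\mathbb{N})$; a T3 oracle is a total function $\mathbb{N}\to\mathcal{P}(\mathcal{P}(\mathbb{N}))$; a basic (T3) oracle is an element of $\mathcal{P}(\mathcal{P}(\mathbb{N}))$. Identifications: a T0 oracle is a T1 oracle that happens to be total; a T1 oracle $g$ is identified with the T2 oracle $n\mapsto\{g(n)\}$ (undefined where $g$ is); a T2 oracle $g$ is identified with the T3 oracle $n\mapsto\{g(n)\}$ if $g(n)$ is defined and $n\mapsto\varnothing$ otherwise; a basic oracle is identified with the corresponding constant T3 oracle. Reduction game of $f$ to $g$ (for T3 oracles $f,g$). Players Arthur and Nimue are allied against Merlin. The initial configuration is any $m\in\mathbb{N}$ together with a set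 $F\in f(m)$; Arthur sees only $m$, while Nimue and Merlin see both. Arthur, Nimue, Merlin then play in turn, repeatedly. At his turn Arthur either declares a final value $u\in\mathbb{N}$, ending the game (Arthur and Nimue win iff $u\in F$), or queries the oracle at some $n\in\mathbb{N}$. If $g(n)=\varnothing$, Arthur and Nimue lose immediately; otherwise Nimue chooses $G\in g(n)$ (seen by Merlin, not by Arthur). If $G=\varnothing$, Merlin loses immediately; otherwise Merlin chooses $v\in G$, which everyone sees, and it is Arthur's turn again. If the game never ends, Merlin wins. An Arthur strategy is a partial computable function taking $m$ and the finite sequence of Merlin's moves so far to Arthur's next move (if it is undefined or malformed, Arthur and Nimue lose); a Nimue strategy is an arbitrary function of the initial configuration and of all past moves of Arthur and Merlin. A pair of such strategies is winning if Arthur and Nimue win for every initial configuration and all moves of Merlin. One says $f$ is reducible to $g$ if a winning Arthur+Nimue strategy exists. This is a preorder; the T3 degrees $\mathscr{D}_{\mathrm{T3}}$ are the poset quotient, with order $\leq$. The T0, T1, T2, basic T3 degrees are the T3 degrees of T0, T1, T2, basic oracles, with the induced order; the T0 degrees are exactly the Turing degrees with their usual order, $[B]_{\mathrm{T0}}$ is the Turing degree of (the characteristic function of) $B\subseteq\mathbb{N}$, and $\mathbf{0}$ is the degree of the constantly zero function (the degree of computable functions). For $P,Q\subseteq\mathbb{N}$ nonempty and disjoint, $\mathbf{c}_{P,Q}$ (the coding degree) is the T3 degree of the basic oracle $\{P,Q\}$. $\varphi_e^A$ is the $e$-th partial computable function with oracle $A$ (numbering independent of the oracle). For $A\subseteq\mathbb{N}$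 and $i\in\{0,1\}$, $H_i^A := \{e \mid \varphi_e^A(0)\text{ is defined and equals } i\}$, and $\tilde{\mathbf{c}}_A := \mathbf{c}_{H_0^A,H_1^A}$. The T3 degree $\tilde{\mathbf{c}}_A$ depends only on the Turing degree $[A]_{\mathrm{T0}}$, and one writes $\operatorname{coT}([A]_{\mathrm{T0}}) := \tilde{\mathbf{c}}_A$. *)

theory Defs
  imports "HOL-Library.Nat_Bijection"
begin

section \<open>Partial computable functions with an oracle\<close>

text \<open>
  Kleene's partial recursive functions, presented as functions of a single natural number:
  several arguments are passed as one, by means of the computable bijection
  \<^const>\<open>prod_encode\<close> between pairs and natural numbers. Composing \<open>PPair\<close>, \<open>PFst\<close> and \<open>PSnd\<close>
  gives tupling and the projections; in particular \<open>PPair PFst PSnd\<close> is the identity.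
\<close>

datatype prog =
    PZero
  | PSucc
  | PFst
  | PSnd
  | POracle
  | PPair prog prog
  | PComp prog prog
  | PRec prog prog
  | PMu prog

definition charf :: "nat set \<Rightarrow> nat \<Rightarrow> nat" where
  "charf A x = (if x \<in> A then 1 else 0)"

text \<open>\<open>computes A p x y\<close>: the program \<open>p\<close>, with oracle \<open>A\<close>, halts on input \<open>x\<close> with value \<open>y\<close>.\<close>

inductive computes :: "nat set \<Rightarrow> prog \<Rightarrow> nat \<Rightarrow> nat \<Rightarrow> bool" for A :: "nat set" where
  zero: "computes A PZero x 0"
| succ: "computes A PSucc x (Suc x)"
| fst: "computes A PFst (prod_encode (x, y)) x"
| snd: "computes A PSnd (prod_encode (x, y)) y"
| query: "computes A POracle x (charf A x)"
| pair: "\<lbrakk> computes A p x y; computes A q x z \<rbrakk> \<Longrightarrow> computes A (PPair p q) x (prod_encode (y, z))"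
| comp: "\<lbrakk> computes A q x y; computes A p y z \<rbrakk> \<Longrightarrow> computes A (PComp p q) x z"
| rec_0: "computes A p x y \<Longrightarrow> computes A (PRec p q) (prod_encode (x, 0)) y"
| rec_Suc: "\<lbrakk> computes A (PRec p q) (prod_encode (x, n)) y;
              computes A q (prod_encode (x, prod_encode (n, y))) z \<rbrakk>
            \<Longrightarrow> computes A (PRec p q) (prod_encode (x, Suc n)) z"
| mu: "\<lbrakk> computes A p (prod_encode (x, n)) 0;
         \<forall>k<n. \<exists>y. computes A p (prod_encode (x, k)) (Suc y) \<rbrakk>
       \<Longrightarrow> computes A (PMu p) x n"

lemma computes_deterministic:
  "computes A p x y \<Longrightarrow> computes A p x z \<Longrightarrow> y = z"
proof (induction arbitrary: z rule: computes.induct)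
  case (zero x)
  then show ?case by cases simp
next
  case (succ x)
  then show ?case by cases simp
next
  case (fst x y)
  then show ?case by cases simp
next
  case (snd x y)
  then show ?case by cases simp
next
  case (query x)
  then show ?case by cases simp
next
  case (pair p x y q y')
  from pair.prems show ?case by cases (use pair.IH in blast)
next
  case (comp q x y p y')
  from comp.prems show ?case by cases (use comp.IH in blast)
next
  case (rec_0 p x y q)
  from rec_0.prems show ?case by cases (use rec_0.IH in auto)
next
  case (rec_Suc p q x n y y')
  from rec_Suc.prems show ?case by cases (use rec_Suc.IH in auto)
next
  case (mu p x n)
  from mu.prems show ?case
  proof cases
    case mu': mu
    have "\<not> z < n"
    proof
      assume "z < n"
      then obtain y where "\<And>u. computes A p (prod_encode (x, z)) u \<Longrightarrow> Suc y = u"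
        using mu.IH(2) by blast
      then show False using mu'(1) by blast
    qed
    moreover have "\<not> n < z"
    proof
      assume "n < z"
      then obtain y where "computes A p (prod_encode (x, n)) (Suc y)"
        using mu'(2) by blast
      then show False using mu.IH(1) by blast
    qed
    ultimately show ?thesis by simp
  qed
qed

text \<open>
  An effective bijective Goedel numbering of the programs. It yields an acceptable numbering of
  the partial computable functions, and it does not depend on the oracle.
\<close>

primrec prog_code :: "prog \<Rightarrow> nat" where
  "prog_code PZero = 0"
| "prog_code PSucc = 1"
| "prog_code PFst = 2"
| "prog_code PSnd = 3"
| "prog_code POracle = 4"
| "prog_code (PPair p q) = 5 + 4 * prod_encode (prog_code p, prog_code q)"
| "prog_code (PComp p q) = 6 + 4 * prod_encode (prog_code p, prog_code q)"
| "prog_code (PRec p q) = 7 + 4 * prod_encode (prog_code p, prog_code q)"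
| "prog_code (PMu p) = 8 + 4 * prog_code p"

lemma inj_prog_code: "inj prog_code"
proof (rule injI)
  have mod: "5 + 4 * a \<noteq> 6 + 4 * b" "5 + 4 * a \<noteq> 7 + 4 * b" "5 + 4 * a \<noteq> 8 + 4 * b"
    "6 + 4 * a \<noteq> 7 + 4 * b" "6 + 4 * a \<noteq> 8 + 4 * b" "7 + 4 * a \<noteq> 8 + 4 * b" for a b :: nat
    by presburger+
  show "prog_code p = prog_code q \<Longrightarrow> p = q" for p q
  proof (induction p arbitrary: q)
    case (PPair p1 p2)
    then show ?case by (cases q) (simp_all add: mod mod[symmetric])
  next
    case (PComp p1 p2)
    then show ?case by (cases q) (simp_all add: mod mod[symmetric])
  next
    case (PRec p1 p2)
    then show ?case by (cases q) (simp_all add: mod mod[symmetric])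
  next
    case (PMu p)
    then show ?case by (cases q) (simp_all add: mod mod[symmetric])
  qed (case_tac q; simp)+
qed

lemma surj_prog_code: "surj prog_code"
proof -
  have "n \<in> range prog_code" for n
  proof (induction n rule: less_induct)
    case (less n)
    have pair: "\<exists>p q. k = prod_encode (prog_code p, prog_code q)" if "k < n" for k
    proof -
      obtain i j where "prod_decode k = (i, j)" by fastforce
      then have k: "k = prod_encode (i, j)" by (metis prod_decode_inverse)
      then have "i < n" "j < n"
        using that le_prod_encode_1 le_prod_encode_2 le_less_trans by blast+
      then show ?thesis using less k by blast
    qed
    have "n < 5 \<or> (\<exists>k. n = 5 + 4 * k \<or> n = 6 + 4 * k \<or> n = 7 + 4 * k \<or> n = 8 + 4 * k)"
      by presburger
    then consider "n < 5" | k where "k < n" "n = 5 + 4 * k" | k where "k < n" "n = 6 + 4 * k"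
      | k where "k < n" "n = 7 + 4 * k" | k where "k < n" "n = 8 + 4 * k"
      by fastforce
    then show ?case
    proof cases
      case 1
      then have "n = 0 \<or> n = 1 \<or> n = 2 \<or> n = 3 \<or> n = 4" by linarith
      then show ?thesis using prog_code.simps(1-5) rangeI by metis
    next
      case (2 k)
      then show ?thesis using pair[of k] prog_code.simps(6) rangeI by metis
    next
      case (3 k)
      then show ?thesis using pair[of k] prog_code.simps(7) rangeI by metis
    next
      case (4 k)
      then show ?thesis using pair[of k] prog_code.simps(8) rangeI by metis
    next
      case (5 k)
      then obtain p where "k = prog_code p" using less by blast
      then show ?thesis using 5 prog_code.simps(9) rangeI by metis
    qed
  qed
  then show ?thesis by blast
qed

definition phi :: "nat set \<Rightarrow> nat \<Rightarrow> nat \<Rightarrow> nat option" where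
  "phi A e x =
     (let p = inv prog_code e
      in if \<exists>y. computes A p x y then Some (THE y. computes A p x y) else None)"

lemma phi_prog_code: "phi A (prog_code p) x = Some y \<longleftrightarrow> computes A p x y"
proof -
  have "(THE z. computes A p x z) = y'" if "computes A p x y'" for y'
    using that computes_deterministic by (intro the_equality) auto
  then show ?thesis
    unfolding phi_def Let_def inv_f_f[OF inj_prog_code] by force
qed

text \<open>Computability without an oracle is computability with the oracle \<open>{}\<close>.\<close>

definition partial_computable :: "(nat \<Rightarrow> nat option) \<Rightarrow> bool" where
  "partial_computable h \<longleftrightarrow> (\<exists>e. h = phi {} e)"

definition computable_set :: "nat set \<Rightarrow> bool" where
  "computable_set A \<longleftrightarrow> partial_computable (\<lambda>x. Some (charf A x))"

section \<open>Oracles\<close>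

type_synonym T0_oracle = "nat \<Rightarrow> nat"
type_synonym T1_oracle = "nat \<Rightarrow> nat option"
type_synonym T2_oracle = "nat \<Rightarrow> nat set option"
type_synonym T3_oracle = "nat \<Rightarrow> nat set set"
type_synonym basic_oracle = "nat set set"

definition T1_of_T0 :: "T0_oracle \<Rightarrow> T1_oracle" where
  "T1_of_T0 g n = Some (g n)"

definition T2_of_T1 :: "T1_oracle \<Rightarrow> T2_oracle" where
  "T2_of_T1 g n = map_option (\<lambda>v. {v}) (g n)"

definition T3_of_T2 :: "T2_oracle \<Rightarrow> T3_oracle" where
  "T3_of_T2 g n = (case g n of None \<Rightarrow> {} | Some G \<Rightarrow> {G})"

definition T3_of_T0 :: "T0_oracle \<Rightarrow> T3_oracle" where
  "T3_of_T0 g = T3_of_T2 (T2_of_T1 (T1_of_T0 g))"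

definition T3_of_basic :: "basic_oracle \<Rightarrow> T3_oracle" where
  "T3_of_basic \<G> n = \<G>"

section \<open>The reduction game\<close>

text \<open>
  Arthur's strategy is a partial function on natural numbers; it receives his part \<open>m\<close> of the
  initial configuration and the list of Merlin's moves so far (oldest first) in encoded form.
  Its value encodes either a declared value (\<open>Inl u\<close>) or a query (\<open>Inr n\<close>). As
  \<^const>\<open>sum_decode\<close> is total, no value is malformed.
\<close>

definition arthur_move :: "(nat \<Rightarrow> nat option) \<Rightarrow> nat \<Rightarrow> nat list \<Rightarrow> (nat + nat) option" where
  "arthur_move \<alpha> m vs = map_option sum_decode (\<alpha> (prod_encode (m, list_encode vs)))"

text \<open>
  Nimue's strategy maps the initial configuration \<open>m\<close>, \<open>F\<close>, Arthur's queries (including the one to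
  be answered) and Merlin's moves, both oldest first, to her choice.
\<close>

type_synonym nimue_strategy = "nat \<Rightarrow> nat set \<Rightarrow> nat list \<Rightarrow> nat list \<Rightarrow> nat set"

text \<open>
  At \<open>Running ns vs\<close> it is Arthur's turn, \<open>ns\<close> being his queries and \<open>vs\<close> Merlin's moves so far.
  \<open>Won\<close> and \<open>Lost\<close> are from the point of view of Arthur and Nimue.
\<close>

datatype game_state = Running "nat list" "nat list" | Won | Lost

text \<open>
  One round, in which Merlin is to answer \<open>v\<close>. Nimue loses if her choice is not in \<open>g n\<close>, which is
  inevitable when \<open>g n = {}\<close>; Merlin loses if \<open>v\<close> is not in \<open>G\<close>, which is inevitable when
  \<open>G = {}\<close>.
\<close>

fun game_round ::
  "T3_oracle \<Rightarrow> (nat \<Rightarrow> nat option) \<Rightarrow> nimue_strategy \<Rightarrow> nat \<Rightarrow> nat set \<Rightarrow> nat \<Rightarrow>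
    game_state \<Rightarrow> game_state" where
  "game_round g \<alpha> \<nu> m F v (Running ns vs) =
     (case arthur_move \<alpha> m vs of
        None \<Rightarrow> Lost
      | Some (Inl u) \<Rightarrow> if u \<in> F then Won else Lost
      | Some (Inr n) \<Rightarrow>
          let G = \<nu> m F (ns @ [n]) vs
          in if G \<notin> g n then Lost
             else if v \<notin> G then Won
             else Running (ns @ [n]) (vs @ [v]))"
| "game_round g \<alpha> \<nu> m F v Won = Won"
| "game_round g \<alpha> \<nu> m F v Lost = Lost"

text \<open>The state after \<open>k\<close> rounds in which Merlin moves according to the sequence \<open>w\<close>.\<close>

primrec game_play ::
  "T3_oracle \<Rightarrow> (nat \<Rightarrow> nat option) \<Rightarrow> nimue_strategy \<Rightarrow> nat \<Rightarrow> nat set \<Rightarrow> (nat \<Rightarrow> nat) \<Rightarrow>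
    nat \<Rightarrow> game_state" where
  "game_play g \<alpha> \<nu> m F w 0 = Running [] []"
| "game_play g \<alpha> \<nu> m F w (Suc k) = game_round g \<alpha> \<nu> m F (w k) (game_play g \<alpha> \<nu> m F w k)"

definition winning_pair ::
  "T3_oracle \<Rightarrow> T3_oracle \<Rightarrow> (nat \<Rightarrow> nat option) \<Rightarrow> nimue_strategy \<Rightarrow> bool" where
  "winning_pair f g \<alpha> \<nu> \<longleftrightarrow> (\<forall>m. \<forall>F \<in> f m. \<forall>w. \<exists>k. game_play g \<alpha> \<nu> m F w k = Won)"

definition T3_reducible :: "T3_oracle \<Rightarrow> T3_oracle \<Rightarrow> bool" where
  "T3_reducible f g \<longleftrightarrow> (\<exists>\<alpha> \<nu>. partial_computable \<alpha> \<and> winning_pair f g \<alpha> \<nu>)"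

section \<open>Degrees\<close>

text \<open>Degrees are the equivalence classes of the preorder \<^const>\<open>T3_reducible\<close>.\<close>

type_synonym T3_degree = "T3_oracle set"

definition T3_deg :: "T3_oracle \<Rightarrow> T3_degree" where
  "T3_deg f = {g. T3_reducible f g \<and> T3_reducible g f}"

definition deg_le :: "T3_degree \<Rightarrow> T3_degree \<Rightarrow> bool" (infix "\<le>\<^sub>T\<^sub>3" 50) where
  "x \<le>\<^sub>T\<^sub>3 y \<longleftrightarrow> (\<exists>f \<in> x. \<exists>g \<in> y. T3_reducible f g)"

definition T0_degrees :: "T3_degree set" where
  "T0_degrees = {T3_deg (T3_of_T0 g) | g. True}"

definition T0_deg :: "nat set \<Rightarrow> T3_degree" where
  "T0_deg B = T3_deg (T3_of_T0 (charf B))"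

definition zero_deg :: T3_degree where
  "zero_deg = T3_deg (T3_of_T0 (\<lambda>_. 0))"

definition coding_deg :: "nat set \<Rightarrow> nat set \<Rightarrow> T3_degree" where
  "coding_deg P Q = T3_deg (T3_of_basic {P, Q})"

definition H :: "nat \<Rightarrow> nat set \<Rightarrow> nat set" where
  "H i A = {e. phi A e 0 = Some i}"

lemma H_disjoint: "H 0 A \<inter> H 1 A = {}"
  by (auto simp: H_def)

lemma H_nonempty: "H 0 A \<noteq> {}" "H 1 A \<noteq> {}"
proof -
  have "computes A PZero 0 0"
    by (rule computes.zero)
  moreover have "computes A (PComp PSucc PZero) 0 1"
    unfolding One_nat_def by (rule computes.comp[OF computes.zero computes.succ])
  ultimately have "prog_code PZero \<in> H 0 A" "prog_code (PComp PSucc PZero) \<in> H 1 A"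
    unfolding H_def mem_Collect_eq phi_prog_code by blast+
  then show "H 0 A \<noteq> {}" "H 1 A \<noteq> {}" by blast+
qed

definition ctilde :: "nat set \<Rightarrow> T3_degree" where
  "ctilde A = coding_deg (H 0 A) (H 1 A)"

text \<open>
  \<open>ctilde A\<close> depends only on \<open>T0_deg A\<close>, and every element of \<^const>\<open>T0_degrees\<close> is \<open>T0_deg A\<close> for
  some \<open>A\<close>, so any representative may be chosen.
\<close>

definition coT :: "T3_degree \<Rightarrow> T3_degree" where
  "coT a = ctilde (SOME A. T0_deg A = a)"

end

theory Submission
  imports Defs
begin

text \<open>
  \<^bold>\<open>A total oracle \<open>f\<close> below \<open>ctilde A\<close>.\<close> Against the basic oracle \<open>{H 0 A, H 1 A}\<close> it does not matter
  what Arthur asks: in each round Nimue names a bit \<open>b\<close>, and Merlin hides it behind an index in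
  \<open>H b A\<close>. Let \<open>\<alpha>\<close> be Arthur's half of a winning strategy for \<open>f\<close>. For a given number \<open>n\<close> consider
  only four of Merlin's replies: a fixed index in \<open>H 0 A\<close>, a fixed index in \<open>H 1 A\<close>, and the indices
  of programs that ask the oracle for the bit \<open>A(n)\<close> and return it, respectively its negation. All
  four are computable from \<open>n\<close>. Under the hypothesis \<open>A(n) = i\<close> two of them are known to be legal
  replies to the bit \<open>b\<close>, namely \<open>fixed_move b\<close> and \<open>bit_move n i b\<close>. Call \<open>forces \<alpha> m n i u s\<close> the
  statement that, on input \<open>m\<close> and from the history \<open>s\<close>, Nimue can bring Arthur to declare \<open>u\<close> against
  a Merlin who is confined to these two replies. A witness is a finite tree, so this is
  semidecidable. It has two properties.

  \<^item> With the true hypothesis the true value is forced: \<open>forces \<alpha> m n (charf A n) (f m)\<close> holds at the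
    start of the game (\<open>forces_if_wins\<close>).
  \<^item> Opposite hypotheses cannot force different values (\<open>forces_opposite_agree\<close>). Indeed, if two
    trees choose the bits \<open>b\<close> and \<open>b'\<close> at the same position, then the two pairs of replies meet: in
    the fixed index if \<open>b = b'\<close>, and in the other one if \<open>b \<noteq> b'\<close>, because then both the bit and the
    hypothesis are flipped. Hence the two trees have a common branch, at whose end Arthur declares a
    single value.

  Suppose first that for every \<open>m\<close> there are \<open>n\<close> and \<open>u\<close> such that both hypotheses on \<open>A(n)\<close> force
  \<open>u\<close>. One of the hypotheses is false, and the true one forces \<open>f m\<close>, so \<open>u = f m\<close>, and searching
  for \<open>n\<close> and \<open>u\<close> computes \<open>f\<close>. Otherwise fix an \<open>m\<close> for which there are none, and keep the number
  \<open>u = f m\<close> as a constant. For every \<open>n\<close> the true hypothesis forces \<open>u\<close> and the false one does not, so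
  searching for the hypothesis that forces \<open>u\<close> computes \<open>A\<close>. This is
  \<open>computable_if_below_coding\<close>. Conversely, if \<open>A\<close> is computable then Nimue can send Arthur the bit
  \<open>B(m)\<close> in one round, because Arthur can run the program that Merlin names.

  \<^bold>\<open>A coding degree below a total oracle.\<close> A total oracle leaves no choice to Nimue or to Merlin.
  Arthur sees the same play for both initial configurations of \<open>{P, Q}\<close>, hence declares the same
  value, which would have to lie in both of the disjoint sets \<open>P\<close> and \<open>Q\<close>.

  \<^bold>\<open>Computability without programming.\<close> A partial function is computable as soon as its graph is
  semidecidable. Semidecidable predicates are closed under conjunction, disjunction, existential
  quantification and, by \<open>semidecidable_derivable\<close>, inductive definitions with semidecidable rules.
  The universal machine, the composition of two strategies (needed for the transitivity of
  reducibility) and the trees above are all obtained as such inductive definitions.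
\<close>

section \<open>Total computable functions\<close>

text \<open>
  Codes of structured data are iterated pairs. As abbreviations, the pairing and its projections
  are open to the simplification rules for the library's pairing function.
\<close>

abbreviation pair_code :: "nat \<Rightarrow> nat \<Rightarrow> nat" ("\<langle>_,/ _\<rangle>") where
  "\<langle>x, y\<rangle> \<equiv> prod_encode (x, y)"

abbreviation pi1 :: "nat \<Rightarrow> nat" where "pi1 n \<equiv> fst (prod_decode n)"
abbreviation pi2 :: "nat \<Rightarrow> nat" where "pi2 n \<equiv> snd (prod_decode n)"

lemma pair_pi: "\<langle>pi1 n, pi2 n\<rangle> = n"
  by simp

definition computable_fun :: "(nat \<Rightarrow> nat) \<Rightarrow> bool" where
  "computable_fun f \<longleftrightarrow> (\<exists>p. \<forall>x. computes {} p x (f x))"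

text \<open>
  The closure rules are stated for functions of one number given by an arbitrary term in that
  number. Applied backwards, they prove that a term is computable by following its structure.
\<close>

named_theorems computable_intros

lemma computable_comp:
  assumes "computable_fun f" "computable_fun g"
  shows "computable_fun (\<lambda>x. f (g x))"
proof -
  from assms obtain p q where "\<And>x. computes {} p x (f x)" "\<And>x. computes {} q x (g x)"
    unfolding computable_fun_def by blast
  then have "computes {} (PComp p q) x (f (g x))" for x
    using computes.comp by blast
  then show ?thesis unfolding computable_fun_def by blast
qed

lemma computable_pi1: "computable_fun pi1" and computable_pi2: "computable_fun pi2"
  unfolding computable_fun_def
  using computes.fst[of "{}" "pi1 x" "pi2 x" for x] computes.snd[of "{}" "pi1 x" "pi2 x" for x]
  by (metis pair_pi)+

lemma computable_pair [computable_intros]: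
  assumes "computable_fun f" "computable_fun g"
  shows "computable_fun (\<lambda>x. \<langle>f x, g x\<rangle>)"
  using assms unfolding computable_fun_def by (meson computes.pair)

lemma computable_id [computable_intros]: "computable_fun (\<lambda>x. x)"
  using computable_pair[OF computable_pi1 computable_pi2] by simp

lemma computable_Suc [computable_intros]:
  "computable_fun f \<Longrightarrow> computable_fun (\<lambda>x. Suc (f x))"
  using computable_comp[of Suc f] computes.succ unfolding computable_fun_def by blast

lemma computable_const [computable_intros]: "computable_fun (\<lambda>_. c)"
proof (induction c)
  case 0
  then show ?case using computes.zero unfolding computable_fun_def by blast
qed (rule computable_Suc)

lemmas computable_fst [computable_intros] = computable_comp[OF computable_pi1]
lemmas computable_snd [computable_intros] = computable_comp[OF computable_pi2]

text \<open>
  A step function with several arguments is supplied with them as a single number, in the order in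
  which \<open>PRec\<close> passes them: the parameter, the stage and the previous value.
\<close>

lemma computable_rec [computable_intros]:
  assumes "computable_fun b" "computable_fun (\<lambda>w. s (pi1 w) (pi1 (pi2 w)) (pi2 (pi2 w)))"
    "computable_fun k"
  shows "computable_fun (\<lambda>x. rec_nat (b x) (s x) (k x))"
proof -
  from assms obtain p q where p: "\<And>x. computes {} p x (b x)"
    and q: "\<And>x. computes {} q x (s (pi1 x) (pi1 (pi2 x)) (pi2 (pi2 x)))"
    unfolding computable_fun_def by blast
  have "computes {} (PRec p q) \<langle>x, n\<rangle> (rec_nat (b x) (s x) n)" for x n
  proof (induction n)
    case (Suc n)
    then show ?case using q[of "\<langle>x, \<langle>n, rec_nat (b x) (s x) n\<rangle>\<rangle>"]
      by (auto intro: computes.rec_Suc)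
  qed (simp add: computes.rec_0 p)
  then have "computes {} (PRec p q) x (rec_nat (b (pi1 x)) (s (pi1 x)) (pi2 x))" for x
    using pair_pi by metis
  then have "computable_fun (\<lambda>x. rec_nat (b (pi1 x)) (s (pi1 x)) (pi2 x))"
    unfolding computable_fun_def by blast
  from computable_comp[OF this computable_pair[OF computable_id assms(3)]]
  show ?thesis by simp
qed

lemma computable_funpow [computable_intros]:
  assumes "computable_fun f" "computable_fun g" "computable_fun k"
  shows "computable_fun (\<lambda>x. (f ^^ k x) (g x))"
proof -
  have "(f ^^ n) a = rec_nat a (\<lambda>_. f) n" for n a
    by (induction n) auto
  moreover have "computable_fun (\<lambda>x. rec_nat (g x) (\<lambda>_. f) (k x))"
    by (intro computable_intros assms computable_comp[OF assms(1)])
  ultimately show ?thesis by simp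
qed

lemma computable_pred [computable_intros]:
  assumes "computable_fun f"
  shows "computable_fun (\<lambda>x. f x - 1)"
proof -
  have "rec_nat 0 (\<lambda>n _. n) k = k - 1" for k :: nat
    by (cases k) auto
  moreover have "computable_fun (\<lambda>x. rec_nat 0 (\<lambda>n _. n) (f x))"
    by (intro computable_intros assms)
  ultimately show ?thesis by simp
qed

lemma computable_add [computable_intros]:
  assumes "computable_fun f" "computable_fun g"
  shows "computable_fun (\<lambda>x. f x + g x)"
proof -
  have "(Suc ^^ n) k = k + n" for k n
    by (induction n) auto
  moreover have "computable_fun (\<lambda>x. (Suc ^^ g x) (f x))"
    by (intro computable_intros assms)
  ultimately show ?thesis by (simp only:)
qed

lemma computable_mult [computable_intros]:
  assumes "computable_fun f" "computable_fun g"
  shows "computable_fun (\<lambda>x. f x * g x)"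
proof -
  have "rec_nat 0 (\<lambda>_ r. k + r) n = k * n" for k n
    by (induction n) auto
  moreover have "computable_fun (\<lambda>x. rec_nat 0 (\<lambda>_ r. f x + r) (g x))"
    by (intro computable_intros assms computable_comp[OF assms(1)])
  ultimately show ?thesis by simp
qed

lemma computable_diff [computable_intros]:
  assumes "computable_fun f" "computable_fun g"
  shows "computable_fun (\<lambda>x. f x - g x)"
proof -
  have "((\<lambda>r. r - 1) ^^ n) k = k - n" for k n :: nat
    by (induction n) auto
  moreover have "computable_fun (\<lambda>x. ((\<lambda>r. r - 1) ^^ g x) (f x))"
    by (intro computable_intros assms)
  ultimately show ?thesis by simp
qed

lemma computable_if_eq [computable_intros]:
  assumes "computable_fun f" "computable_fun g" "computable_fun a" "computable_fun b"
  shows "computable_fun (\<lambda>x. if f x = g x then a x else b x)"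
proof -
  have "rec_nat s (\<lambda>_ _. t) ((k - n) + (n - k)) = (if k = n then s else t)" for k n s t :: nat
    by (cases "(k - n) + (n - k)") auto
  moreover have "computable_fun (\<lambda>x. rec_nat (a x) (\<lambda>_ _. b x) ((f x - g x) + (g x - f x)))"
    by (intro computable_intros assms computable_comp[OF assms(4)])
  ultimately show ?thesis by simp
qed

definition snoc_code :: "nat \<Rightarrow> nat \<Rightarrow> nat" where
  "snoc_code l v = list_encode (list_decode l @ [v])"

lemma snoc_code_list_encode [simp]: "snoc_code (list_encode vs) v = list_encode (vs @ [v])"
  by (simp add: snoc_code_def)

lemma length_le_list_encode: "length xs \<le> list_encode xs"
proof (induction xs)
  case (Cons x xs)
  then show ?case using le_prod_encode_2[of "list_encode xs" x] by simp
qed simp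

text \<open>
  Appending at the end of a coded list is a reversal, a \<open>Cons\<close> and another reversal. A reversal
  moves one entry at a time from the first list of a pair to the second one. As the step does
  nothing once the first list is empty, the code of a list, which is at least its length, may serve
  as the number of iterations.
\<close>

definition rev_step :: "nat \<Rightarrow> nat" where
  "rev_step s = (if pi1 s = 0 then s
     else \<langle>pi2 (pi1 s - 1), Suc \<langle>pi1 (pi1 s - 1), pi2 s\<rangle>\<rangle>)"

lemma rev_step_funpow:
  "(rev_step ^^ k) \<langle>list_encode xs, list_encode ys\<rangle> =
     \<langle>list_encode (drop k xs), list_encode (rev (take k xs) @ ys)\<rangle>"
proof (induction k arbitrary: xs ys)
  case (Suc k)
  show ?case
  proof (cases xs)
    case Nil
    have "(rev_step ^^ n) \<langle>0, c\<rangle> = \<langle>0, c\<rangle>" for n c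
      by (induction n) (simp_all add: rev_step_def)
    then show ?thesis using Nil by (simp del: funpow.simps)
  next
    case (Cons x xs')
    have "rev_step \<langle>list_encode xs, list_encode ys\<rangle> = \<langle>list_encode xs', list_encode (x # ys)\<rangle>"
      by (simp add: rev_step_def Cons)
    then show ?thesis using Suc[of xs' "x # ys"] Cons
      by (simp add: funpow_swap1 funpow_Suc_right del: funpow.simps list_encode.simps)
  qed
qed simp

lemma computable_snoc [computable_intros]:
  assumes "computable_fun f" "computable_fun g"
  shows "computable_fun (\<lambda>x. snoc_code (f x) (g x))"
proof -
  define revc where "revc l = pi2 ((rev_step ^^ l) \<langle>l, 0\<rangle>)" for l
  have revc: "revc (list_encode xs) = list_encode (rev xs)" for xs
    using rev_step_funpow[of "list_encode xs" xs "[]"] length_le_list_encode[of xs]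
    by (simp add: revc_def)
  have "computable_fun rev_step"
    unfolding rev_step_def by (intro computable_intros)
  then have c: "computable_fun revc"
    unfolding revc_def by (intro computable_intros)
  have "computable_fun (\<lambda>x. revc (Suc \<langle>g x, revc (f x)\<rangle>))"
    by (intro computable_intros assms computable_comp[OF c])
  moreover have "revc (Suc \<langle>v, revc l\<rangle>) = snoc_code l v" for l v
    using revc[of "list_decode l"] revc[of "v # rev (list_decode l)"] by (simp add: snoc_code_def)
  ultimately show ?thesis by simp
qed

section \<open>Semidecidable predicates\<close>

text \<open>
  Predicates of the form \<open>\<exists>s. d \<langle>x, s\<rangle> = 0\<close> with a total computable \<open>d\<close> are the domains of unbounded
  searches.
\<close>

definition semidecidable :: "(nat \<Rightarrow> bool) \<Rightarrow> bool" where
  "semidecidable P \<longleftrightarrow> (\<exists>d. computable_fun d \<and> (\<forall>x. P x \<longleftrightarrow> (\<exists>s. d \<langle>x, s\<rangle> = 0)))"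

named_theorems semidecidable_intros

lemma semidecidable_eq [semidecidable_intros]:
  fixes f g :: "nat \<Rightarrow> nat"
  assumes "computable_fun f" "computable_fun g"
  shows "semidecidable (\<lambda>x. f x = g x)"
proof -
  have "computable_fun (\<lambda>w. if f (pi1 w) = g (pi1 w) then 0 else 1)"
    by (intro computable_intros computable_comp[OF assms(1)] computable_comp[OF assms(2)])
  moreover have "f x = g x \<longleftrightarrow> (\<exists>s. (if f (pi1 \<langle>x, s\<rangle>) = g (pi1 \<langle>x, s\<rangle>) then 0 else 1) = (0::nat))" for x
    by simp
  ultimately show ?thesis unfolding semidecidable_def by blast
qed

lemma semidecidable_conj [semidecidable_intros]:
  assumes "semidecidable P" "semidecidable Q"
  shows "semidecidable (\<lambda>x. P x \<and> Q x)"
proof -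
  from assms obtain d e where d: "computable_fun d" "\<And>x. P x \<longleftrightarrow> (\<exists>s. d \<langle>x, s\<rangle> = 0)"
    and e: "computable_fun e" "\<And>x. Q x \<longleftrightarrow> (\<exists>s. e \<langle>x, s\<rangle> = 0)"
    unfolding semidecidable_def by blast
  have "computable_fun (\<lambda>w. d \<langle>pi1 w, pi1 (pi2 w)\<rangle> + e \<langle>pi1 w, pi2 (pi2 w)\<rangle>)"
    by (intro computable_intros computable_comp[OF d(1)] computable_comp[OF e(1)])
  moreover have "P x \<and> Q x \<longleftrightarrow> (\<exists>s. d \<langle>x, pi1 s\<rangle> + e \<langle>x, pi2 s\<rangle> = 0)" for x
    unfolding d(2) e(2) by (metis add_is_0 fst_conv snd_conv prod_encode_inverse)
  ultimately show ?thesis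
    unfolding semidecidable_def by (intro exI conjI allI) (assumption, simp)
qed

lemma semidecidable_disj [semidecidable_intros]:
  assumes "semidecidable P" "semidecidable Q"
  shows "semidecidable (\<lambda>x. P x \<or> Q x)"
proof -
  from assms obtain d e where d: "computable_fun d" "\<And>x. P x \<longleftrightarrow> (\<exists>s. d \<langle>x, s\<rangle> = 0)"
    and e: "computable_fun e" "\<And>x. Q x \<longleftrightarrow> (\<exists>s. e \<langle>x, s\<rangle> = 0)"
    unfolding semidecidable_def by blast
  have "computable_fun (\<lambda>w. d w * e w)"
    by (intro computable_intros computable_comp[OF d(1)] computable_comp[OF e(1)])
  moreover have "P x \<or> Q x \<longleftrightarrow> (\<exists>s. d \<langle>x, s\<rangle> * e \<langle>x, s\<rangle> = 0)" for x
    unfolding d(2) e(2) by auto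
  ultimately show ?thesis
    unfolding semidecidable_def by (intro exI conjI allI) (assumption, simp)
qed

lemma semidecidable_vimage:
  assumes "semidecidable P" "computable_fun f"
  shows "semidecidable (\<lambda>x. P (f x))"
proof -
  from assms obtain d where d: "computable_fun d" "\<And>x. P x \<longleftrightarrow> (\<exists>s. d \<langle>x, s\<rangle> = 0)"
    unfolding semidecidable_def by blast
  have "computable_fun (\<lambda>w. d \<langle>f (pi1 w), pi2 w\<rangle>)"
    by (intro computable_intros computable_comp[OF d(1)] computable_comp[OF assms(2)])
  then show ?thesis
    unfolding semidecidable_def d(2) by (intro exI conjI allI) (assumption, simp)
qed

lemma semidecidable_ex [semidecidable_intros]:
  assumes "semidecidable (\<lambda>w. P (pi1 w) (pi2 w))"
  shows "semidecidable (\<lambda>x. \<exists>y. P x y)"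
proof -
  from assms obtain d where d: "computable_fun d"
    "\<And>w. P (pi1 w) (pi2 w) \<longleftrightarrow> (\<exists>s. d \<langle>w, s\<rangle> = 0)"
    unfolding semidecidable_def by blast
  have P: "P x y \<longleftrightarrow> (\<exists>s. d \<langle>\<langle>x, y\<rangle>, s\<rangle> = 0)" for x y
    using d(2)[of "\<langle>x, y\<rangle>"] by simp
  have "computable_fun (\<lambda>w. d \<langle>\<langle>pi1 w, pi1 (pi2 w)\<rangle>, pi2 (pi2 w)\<rangle>)"
    by (intro computable_intros computable_comp[OF d(1)])
  moreover have "(\<exists>y. P x y) \<longleftrightarrow> (\<exists>s. d \<langle>\<langle>x, pi1 s\<rangle>, pi2 s\<rangle> = 0)" for x
    unfolding P by (metis fst_conv snd_conv prod_encode_inverse)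
  ultimately show ?thesis
    unfolding semidecidable_def by (intro exI conjI allI) (assumption, simp)
qed

text \<open>
  The runs of programs, the outputs of machines and the trees of \<open>forces\<close> are all encoded as
  instances of this definition. Each inference has two premises; a rule with a single premise is
  used with the same premise twice.
\<close>

inductive derivable :: "(nat \<Rightarrow> bool) \<Rightarrow> (nat \<Rightarrow> nat \<Rightarrow> nat \<Rightarrow> bool) \<Rightarrow> nat \<Rightarrow> bool"
  for X :: "nat \<Rightarrow> bool" and R :: "nat \<Rightarrow> nat \<Rightarrow> nat \<Rightarrow> bool" where
  base: "X c \<Longrightarrow> derivable X R c"
| infer: "\<lbrakk> derivable X R a; derivable X R b; R a b c \<rbrakk> \<Longrightarrow> derivable X R c"

text \<open>
  The derivable numbers are enumerated by a computable function \<open>elt\<close>, where the value \<open>Suc c\<close>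
  means that \<open>c\<close> has been derived, and \<open>0\<close> that nothing has. The stage \<open>Suc \<langle>t, \<langle>a, b\<rangle>\<rangle>\<close> tries to
  derive \<open>pi1 t\<close>, either as an axiom or from the results of the stages \<open>a\<close> and \<open>b\<close>, where \<open>pi2 t\<close> is
  the search witness for the axiom or for the rule. Both stages are earlier, as a pairing bounds its
  components. Hence every attempt occurs at some stage, whose result depends on earlier stages only,
  and course-of-values recursion applies: \<open>hist s\<close> codes the list of all results up to \<open>s\<close>, the
  latest one first.
\<close>

theorem semidecidable_derivable:
  assumes X: "semidecidable X"
    and R: "semidecidable (\<lambda>w. R (pi1 w) (pi1 (pi2 w)) (pi2 (pi2 w)))"
  shows "semidecidable (derivable X R)"
proof -
  from X obtain dX where dX: "computable_fun dX" "\<And>x. X x \<longleftrightarrow> (\<exists>s. dX \<langle>x, s\<rangle> = 0)"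
    unfolding semidecidable_def by blast
  from R obtain dR where dR: "computable_fun dR"
    "\<And>w. R (pi1 w) (pi1 (pi2 w)) (pi2 (pi2 w)) \<longleftrightarrow> (\<exists>s. dR \<langle>w, s\<rangle> = 0)"
    unfolding semidecidable_def by blast
  have R_iff: "R a b c \<longleftrightarrow> (\<exists>s. dR \<langle>\<langle>a, \<langle>b, c\<rangle>\<rangle>, s\<rangle> = 0)" for a b c
    using dR(2)[of "\<langle>a, \<langle>b, c\<rangle>\<rangle>"] by simp
  define new where "new t a b =
    (if dX t = 0 then Suc (pi1 t)
     else if a = 0 then 0 else if b = 0 then 0
     else if dR \<langle>\<langle>a - 1, \<langle>b - 1, pi1 t\<rangle>\<rangle>, pi2 t\<rangle> = 0 then Suc (pi1 t) else 0)" for t a b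
  define look where "look s h a = pi1 ((pi2 ^^ (s - a)) h)" for s h a
  define step where "step s h =
    \<langle>new (pi1 s) (look s h (pi1 (pi2 s))) (look s h (pi2 (pi2 s))), h\<rangle>" for s h
  define hist where "hist = rec_nat \<langle>0, 0\<rangle> step"
  define elt where "elt n = pi1 (hist n)" for n
  have hist_simps: "hist 0 = \<langle>0, 0\<rangle>" "hist (Suc s) = step s (hist s)" for s
    by (simp_all add: hist_def)
  have hist_back: "(pi2 ^^ (s - a)) (hist s) = hist a" if "a \<le> s" for s a
    using that
  proof (induction s)
    case (Suc s)
    show ?case
    proof (cases "a = Suc s")
      case False
      then have "a \<le> s" "Suc s - a = Suc (s - a)" using Suc.prems by auto
      then show ?thesis using Suc.IH
        by (simp add: hist_simps step_def funpow_swap1 funpow_Suc_right del: funpow.simps(2))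
    qed simp
  qed simp
  have look: "look s (hist s) a = elt a" if "a \<le> s" for s a
    using hist_back[OF that] by (simp add: look_def elt_def)
  have elt_0: "elt 0 = 0" by (simp add: elt_def hist_simps)
  have le: "pi1 (pi2 s) \<le> s" "pi2 (pi2 s) \<le> s" for s
    using le_prod_encode_1[of "pi1 (pi2 s)" "pi2 (pi2 s)"]
      le_prod_encode_2[of "pi2 (pi2 s)" "pi1 (pi2 s)"] le_prod_encode_2[of "pi2 s" "pi1 s"]
    by simp_all
  have elt_Suc: "elt (Suc s) = new (pi1 s) (elt (pi1 (pi2 s))) (elt (pi2 (pi2 s)))" for s
    using look[OF le(1)] look[OF le(2)] by (simp add: elt_def hist_simps step_def)
  have elt_pair: "elt (Suc \<langle>t, \<langle>a, b\<rangle>\<rangle>) = new t (elt a) (elt b)" for t a b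
    by (simp add: elt_Suc)
  have sound: "derivable X R c" if "elt n = Suc c" for n c
    using that
  proof (induction n arbitrary: c rule: less_induct)
    case (less n)
    then obtain s where n: "n = Suc s" using elt_0 by (cases n) auto
    define t where "t = pi1 s"
    have t: "t = \<langle>c, pi2 t\<rangle>" "new t (elt (pi1 (pi2 s))) (elt (pi2 (pi2 s))) = Suc c"
      using less.prems unfolding n elt_Suc t_def[symmetric]
      by (auto simp: new_def split: if_splits)
    show ?case
    proof (cases "dX t = 0")
      case True
      then have "X c" using dX(2) t(1) by metis
      then show ?thesis by (rule derivable.base)
    next
      case False
      then obtain a b where ab: "elt (pi1 (pi2 s)) = Suc a" "elt (pi2 (pi2 s)) = Suc b"
        "dR \<langle>\<langle>a, \<langle>b, pi1 t\<rangle>\<rangle>, pi2 t\<rangle> = 0"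
        using t(2) by (cases "elt (pi1 (pi2 s))"; cases "elt (pi2 (pi2 s))")
          (auto simp: new_def split: if_splits)
      have "pi1 t = c" using t(1) by (metis fst_conv prod_encode_inverse)
      with ab(3) have "R a b c" unfolding R_iff by blast
      moreover have "derivable X R a"
        by (rule less.IH[OF _ ab(1)]) (simp only: n less_Suc_eq_le le)
      moreover have "derivable X R b"
        by (rule less.IH[OF _ ab(2)]) (simp only: n less_Suc_eq_le le)
      ultimately show ?thesis by (metis derivable.infer)
    qed
  qed
  have complete: "\<exists>n. elt n = Suc c" if "derivable X R c" for c
    using that
  proof induction
    case (base c)
    then obtain s where "dX \<langle>c, s\<rangle> = 0" unfolding dX(2) by blast
    then have "elt (Suc \<langle>\<langle>c, s\<rangle>, \<langle>0, 0\<rangle>\<rangle>) = Suc c"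
      unfolding elt_pair by (simp add: new_def)
    then show ?case by blast
  next
    case (infer a b c)
    then obtain i j s where "elt i = Suc a" "elt j = Suc b" "dR \<langle>\<langle>a, \<langle>b, c\<rangle>\<rangle>, s\<rangle> = 0"
      unfolding R_iff by blast
    then have "elt (Suc \<langle>\<langle>c, s\<rangle>, \<langle>i, j\<rangle>\<rangle>) = Suc c"
      unfolding elt_pair by (simp add: new_def)
    then show ?case by blast
  qed
  have "computable_fun (\<lambda>w. step (pi1 (pi2 w)) (pi2 (pi2 w)))"
    unfolding step_def new_def look_def
    by (intro computable_intros computable_comp[OF dX(1)] computable_comp[OF dR(1)]
        computable_pi2)
  then have "computable_fun (\<lambda>x. rec_nat \<langle>0, 0\<rangle> (\<lambda>s h. step s h) x)"
    by (intro computable_rec[where s = "\<lambda>_ s h. step s h"] computable_intros)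
  then have hist: "computable_fun hist" unfolding hist_def by simp
  have "computable_fun (\<lambda>w. if elt (pi2 w) = Suc (pi1 w) then 0 else 1)"
    unfolding elt_def by (intro computable_intros computable_comp[OF hist])
  moreover have "derivable X R c \<longleftrightarrow>
      (\<exists>n. (if elt (pi2 \<langle>c, n\<rangle>) = Suc (pi1 \<langle>c, n\<rangle>) then 0 else 1) = (0::nat))" for c
    using sound complete by auto
  ultimately show ?thesis unfolding semidecidable_def by blast
qed

text \<open>
  Given \<open>x\<close>, search for a pair of a value \<open>y\<close> and a witness that \<open>h x = Some y\<close>, and return its first
  component. As \<open>h\<close> is a function, every pair that is found carries the correct value.
\<close>

theorem partial_computable_if_semidecidable_graph:
  assumes "semidecidable (\<lambda>w. h (pi1 w) = Some (pi2 w))"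
  shows "partial_computable h"
proof -
  from assms obtain d where d: "computable_fun d"
    "\<And>w. h (pi1 w) = Some (pi2 w) \<longleftrightarrow> (\<exists>s. d \<langle>w, s\<rangle> = 0)"
    unfolding semidecidable_def by blast
  have h: "h x = Some y \<longleftrightarrow> (\<exists>s. d \<langle>\<langle>x, y\<rangle>, s\<rangle> = 0)" for x y
    using d(2)[of "\<langle>x, y\<rangle>"] by simp
  let ?D = "\<lambda>x n. d \<langle>\<langle>x, pi1 n\<rangle>, pi2 n\<rangle>"
  have "computable_fun (\<lambda>v. ?D (pi1 v) (pi2 v))"
    by (intro computable_intros computable_comp[OF d(1)])
  then obtain p where "\<And>v. computes {} p v (?D (pi1 v) (pi2 v))"
    unfolding computable_fun_def by blast
  then have p: "computes {} p \<langle>x, n\<rangle> (?D x n)" for x n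
    by (metis fst_conv snd_conv prod_encode_inverse)
  let ?q = "PComp PFst (PMu p)"
  have "computes {} ?q x y \<longleftrightarrow> h x = Some y" for x y
  proof
    assume "computes {} ?q x y"
    then obtain n where n: "computes {} (PMu p) x n" "computes {} PFst n y"
      by cases auto
    from n(1) have "computes {} p \<langle>x, n\<rangle> 0" by cases auto
    then have "?D x n = 0" using p computes_deterministic by metis
    moreover have "y = pi1 n" using n(2) by cases simp
    ultimately show "h x = Some y" using h by blast
  next
    assume y: "h x = Some y"
    then obtain s where "?D x \<langle>y, s\<rangle> = 0" using h by auto
    then obtain n where n: "?D x n = 0" "\<And>k. k < n \<Longrightarrow> ?D x k \<noteq> 0"
      using exists_least_iff[of "\<lambda>n. ?D x n = 0"] by blast
    then have "pi1 n = y" using y h by (metis option.inject)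
    then have "computes {} PFst n y"
      using computes.fst[of "{}" "pi1 n" "pi2 n"] unfolding pair_pi by simp
    moreover have "computes {} (PMu p) x n"
      using p[of x] n by (intro computes.mu) (metis, metis not0_implies_Suc)
    ultimately show "computes {} ?q x y" by (intro computes.comp)
  qed
  then have "phi {} (prog_code ?q) x = Some y \<longleftrightarrow> h x = Some y" for x y
    by (simp only: phi_prog_code)
  then have "h = phi {} (prog_code ?q)"
    by (metis ext not_Some_eq)
  then show ?thesis unfolding partial_computable_def by blast
qed

section \<open>A universal machine\<close>

lemma partial_computable_Some_iff: "partial_computable (\<lambda>x. Some (f x)) \<longleftrightarrow> computable_fun f"
proof
  assume "partial_computable (\<lambda>x. Some (f x))"
  then obtain e where "\<And>x. phi {} e x = Some (f x)"
    unfolding partial_computable_def by metis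
  moreover obtain p where "e = prog_code p" using surj_prog_code by blast
  ultimately have "computes {} p x (f x)" for x
    using phi_prog_code[of "{}" p] by simp
  then show "computable_fun f"
    unfolding computable_fun_def by blast
next
  assume "computable_fun f"
  then obtain p where "\<forall>x. computes {} p x (f x)"
    unfolding computable_fun_def ..
  then have "phi {} (prog_code p) x = Some (f x)" for x
    by (simp add: phi_prog_code)
  then have "(\<lambda>x. Some (f x)) = phi {} (prog_code p)"
    by (simp add: fun_eq_iff)
  then show "partial_computable (\<lambda>x. Some (f x))"
    unfolding partial_computable_def by blast
qed

lemma computable_set_iff: "computable_set A \<longleftrightarrow> computable_fun (charf A)"
  unfolding computable_set_def by (rule partial_computable_Some_iff)

lemma computable_set_empty: "computable_set {}"
  unfolding computable_set_iff charf_def by (simp add: computable_const)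

text \<open>
  Two kinds of judgement present the semantics of programs with inferences from two premises:
  \<open>run_code e x y\<close> for "the program with code \<open>e\<close> maps \<open>x\<close> to \<open>y\<close>", and \<open>search_code e x n\<close> for "the
  search of \<open>PMu\<close> passes all numbers below \<open>n\<close>". The second one replaces the unboundedly many
  premises of the rule for \<open>PMu\<close>.
\<close>

abbreviation run_code :: "nat \<Rightarrow> nat \<Rightarrow> nat \<Rightarrow> nat" where
  "run_code e x y \<equiv> \<langle>0, \<langle>e, \<langle>x, y\<rangle>\<rangle>\<rangle>"

abbreviation search_code :: "nat \<Rightarrow> nat \<Rightarrow> nat \<Rightarrow> nat" where
  "search_code e x n \<equiv> \<langle>1, \<langle>e, \<langle>x, n\<rangle>\<rangle>\<rangle>"

definition run_axiom :: "nat set \<Rightarrow> nat \<Rightarrow> bool" where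
  "run_axiom A c \<longleftrightarrow>
     (\<exists>x. c = run_code 0 x 0) \<or> (\<exists>x. c = run_code 1 x (Suc x)) \<or>
     (\<exists>x y. c = run_code 2 \<langle>x, y\<rangle> x) \<or> (\<exists>x y. c = run_code 3 \<langle>x, y\<rangle> y) \<or>
     (\<exists>x. c = run_code 4 x (charf A x)) \<or> (\<exists>e x. c = search_code e x 0)"

definition run_rule :: "nat \<Rightarrow> nat \<Rightarrow> nat \<Rightarrow> bool" where
  "run_rule a b c \<longleftrightarrow>
     (\<exists>d e x y z. a = run_code d x y \<and> b = run_code e x z \<and>
        c = run_code (5 + 4 * \<langle>d, e\<rangle>) x \<langle>y, z\<rangle>) \<or>
     (\<exists>d e x y z. a = run_code e x y \<and> b = run_code d y z \<and>
        c = run_code (6 + 4 * \<langle>d, e\<rangle>) x z) \<or>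
     (\<exists>d e x y. a = run_code d x y \<and> c = run_code (7 + 4 * \<langle>d, e\<rangle>) \<langle>x, 0\<rangle> y) \<or>
     (\<exists>d e x n y z. a = run_code (7 + 4 * \<langle>d, e\<rangle>) \<langle>x, n\<rangle> y \<and>
        b = run_code e \<langle>x, \<langle>n, y\<rangle>\<rangle> z \<and> c = run_code (7 + 4 * \<langle>d, e\<rangle>) \<langle>x, Suc n\<rangle> z) \<or>
     (\<exists>e x n y. a = search_code e x n \<and> b = run_code e \<langle>x, n\<rangle> (Suc y) \<and>
        c = search_code e x (Suc n)) \<or>
     (\<exists>e x n. a = search_code e x n \<and> b = run_code e \<langle>x, n\<rangle> 0 \<and>
        c = run_code (8 + 4 * e) x n)"

lemma phi_intros:
  "phi A 0 x = Some 0" "phi A 1 x = Some (Suc x)"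
  "phi A 2 \<langle>x, y\<rangle> = Some x" "phi A 3 \<langle>x, y\<rangle> = Some y" "phi A 4 x = Some (charf A x)"
  "phi A d x = Some y \<Longrightarrow> phi A e x = Some z \<Longrightarrow> phi A (5 + 4 * \<langle>d, e\<rangle>) x = Some \<langle>y, z\<rangle>"
  "phi A e x = Some y \<Longrightarrow> phi A d y = Some z \<Longrightarrow> phi A (6 + 4 * \<langle>d, e\<rangle>) x = Some z"
  "phi A d x = Some y \<Longrightarrow> phi A (7 + 4 * \<langle>d, e\<rangle>) \<langle>x, 0\<rangle> = Some y"
  "phi A (7 + 4 * \<langle>d, e\<rangle>) \<langle>x, n\<rangle> = Some y \<Longrightarrow> phi A e \<langle>x, \<langle>n, y\<rangle>\<rangle> = Some z \<Longrightarrow>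
     phi A (7 + 4 * \<langle>d, e\<rangle>) \<langle>x, Suc n\<rangle> = Some z"
  "phi A e \<langle>x, n\<rangle> = Some 0 \<Longrightarrow> \<forall>k<n. \<exists>y. phi A e \<langle>x, k\<rangle> = Some (Suc y) \<Longrightarrow>
     phi A (8 + 4 * e) x = Some n"
proof -
  obtain p where d: "d = prog_code p" using surj_prog_code by blast
  obtain q where e: "e = prog_code q" using surj_prog_code by blast
  note phi = prog_code.simps(6-9)[symmetric] phi_prog_code d e
  show "phi A 0 x = Some 0"
    using phi_prog_code[of A PZero x 0] computes.zero by (simp only: prog_code.simps)
  show "phi A 1 x = Some (Suc x)"
    using phi_prog_code[of A PSucc x "Suc x"] computes.succ by (simp only: prog_code.simps)
  show "phi A 2 \<langle>x, y\<rangle> = Some x"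
    using phi_prog_code[of A PFst "\<langle>x, y\<rangle>" x] computes.fst by (simp only: prog_code.simps)
  show "phi A 3 \<langle>x, y\<rangle> = Some y"
    using phi_prog_code[of A PSnd "\<langle>x, y\<rangle>" y] computes.snd by (simp only: prog_code.simps)
  show "phi A 4 x = Some (charf A x)"
    using phi_prog_code[of A POracle x "charf A x"] computes.query by (simp only: prog_code.simps)
  show "phi A d x = Some y \<Longrightarrow> phi A e x = Some z \<Longrightarrow> phi A (5 + 4 * \<langle>d, e\<rangle>) x = Some \<langle>y, z\<rangle>"
    unfolding phi by (rule computes.intros)
  show "phi A e x = Some y \<Longrightarrow> phi A d y = Some z \<Longrightarrow> phi A (6 + 4 * \<langle>d, e\<rangle>) x = Some z"
    unfolding phi by (rule computes.intros)
  show "phi A d x = Some y \<Longrightarrow> phi A (7 + 4 * \<langle>d, e\<rangle>) \<langle>x, 0\<rangle> = Some y"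
    unfolding phi by (rule computes.intros)
  show "phi A (7 + 4 * \<langle>d, e\<rangle>) \<langle>x, n\<rangle> = Some y \<Longrightarrow> phi A e \<langle>x, \<langle>n, y\<rangle>\<rangle> = Some z \<Longrightarrow>
     phi A (7 + 4 * \<langle>d, e\<rangle>) \<langle>x, Suc n\<rangle> = Some z"
    unfolding phi by (rule computes.intros)
  show "phi A e \<langle>x, n\<rangle> = Some 0 \<Longrightarrow> \<forall>k<n. \<exists>y. phi A e \<langle>x, k\<rangle> = Some (Suc y) \<Longrightarrow>
     phi A (8 + 4 * e) x = Some n"
    unfolding phi by (rule computes.intros)
qed

lemma phi_if_derivable_run_code:
  assumes "derivable (run_axiom A) run_rule c"
  shows "(\<forall>e x y. c = run_code e x y \<longrightarrow> phi A e x = Some y) \<and>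
    (\<forall>e x n. c = search_code e x n \<longrightarrow> (\<forall>k<n. \<exists>y. phi A e \<langle>x, k\<rangle> = Some (Suc y)))"
  using assms
proof induction
  case (base c)
  then show ?case unfolding run_axiom_def
    by (elim disjE exE) (simp_all add: phi_intros(1-5) phi_intros(2)[unfolded One_nat_def])
next
  case (infer a b c)
  from infer.hyps(3) show ?case unfolding run_rule_def
    by (elim disjE exE conjE) (use infer.IH in \<open>auto simp: phi_intros(6-10) less_Suc_eq\<close>)
qed

lemma derivable_run_code_if_computes:
  assumes "computes A p x y"
  shows "derivable (run_axiom A) run_rule (run_code (prog_code p) x y)"
  using assms
proof induction
  case (pair p x y q z)
  then show ?case by (intro derivable.infer[OF pair.IH]) (auto simp: run_rule_def)
next
  case (comp q x y p z)
  then show ?case by (intro derivable.infer[OF comp.IH]) (auto simp: run_rule_def)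
next
  case (rec_0 p x y q)
  then show ?case by (intro derivable.infer[OF rec_0.IH rec_0.IH]) (auto simp: run_rule_def)
next
  case (rec_Suc p q x n y z)
  then show ?case by (intro derivable.infer[OF rec_Suc.IH]) (auto simp: run_rule_def)
next
  case (mu p x n)
  have "derivable (run_axiom A) run_rule (search_code (prog_code p) x k)" if "k \<le> n" for k
    using that
  proof (induction k)
    case 0
    show ?case by (intro derivable.base) (auto simp: run_axiom_def)
  next
    case (Suc k)
    from Suc.prems have "k < n" by simp
    then obtain y where y: "derivable (run_axiom A) run_rule
        (run_code (prog_code p) \<langle>x, k\<rangle> (Suc y))"
      using mu.IH(2) by blast
    have "derivable (run_axiom A) run_rule (search_code (prog_code p) x k)"
      using Suc by simp
    from this y show ?case by (rule derivable.infer) (auto simp: run_rule_def)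
  qed
  from this[OF order.refl] mu.IH(1) show ?case by (rule derivable.infer) (auto simp: run_rule_def)
qed (intro derivable.base; auto simp: run_axiom_def)+

text \<open>
  This is the universal machine. A computable oracle is harmless, as its answers are axioms that can
  be recognised.
\<close>

theorem semidecidable_phi:
  assumes A: "computable_set A" and "computable_fun e" "computable_fun x" "computable_fun y"
  shows "semidecidable (\<lambda>w. phi A (e w) (x w) = Some (y w))"
proof -
  have charf: "computable_fun (charf A)" using A computable_set_iff by blast
  have "semidecidable (run_axiom A)"
    unfolding run_axiom_def
    by (intro semidecidable_intros computable_intros computable_comp[OF charf])
  moreover have "semidecidable (\<lambda>w. run_rule (pi1 w) (pi1 (pi2 w)) (pi2 (pi2 w)))"
    unfolding run_rule_def by (intro semidecidable_intros computable_intros)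
  ultimately have "semidecidable (derivable (run_axiom A) run_rule)"
    by (rule semidecidable_derivable)
  then have "semidecidable (\<lambda>w. derivable (run_axiom A) run_rule (run_code (e w) (x w) (y w)))"
    by (rule semidecidable_vimage) (intro computable_intros assms)
  moreover have "phi A e x = Some y \<longleftrightarrow> derivable (run_axiom A) run_rule (run_code e x y)" for e x y
    using derivable_run_code_if_computes phi_if_derivable_run_code phi_prog_code surj_prog_code
    by (metis surj_def)
  ultimately show ?thesis by simp
qed

lemma semidecidable_partial_computable:
  assumes "partial_computable h" "computable_fun x" "computable_fun y"
  shows "semidecidable (\<lambda>w. h (x w) = Some (y w))"
  using assms semidecidable_phi[OF computable_set_empty computable_const]
  unfolding partial_computable_def by auto

lemma partial_computable_if_single_valued:
  assumes "semidecidable (\<lambda>w. P (pi1 w) (pi2 w))"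
    and "\<And>x y z. P x y \<Longrightarrow> P x z \<Longrightarrow> y = z"
  shows "\<exists>h. partial_computable h \<and> (\<forall>x y. h x = Some y \<longleftrightarrow> P x y)"
proof -
  define h where "h x = (if \<exists>y. P x y then Some (THE y. P x y) else None)" for x
  have h: "h x = Some y \<longleftrightarrow> P x y" for x y
  proof -
    have "(THE y. P x y) = z" if "P x z" for z
      using that assms(2) by (intro the_equality)
    then show ?thesis unfolding h_def by (auto split: if_splits)
  qed
  then have "partial_computable h"
    using assms(1) by (intro partial_computable_if_semidecidable_graph) simp
  with h show ?thesis by blast
qed

section \<open>Winning positions of the reduction game\<close>

text \<open>
  The positions from which Arthur, following \<open>\<alpha>\<close>, and a suitable Nimue win. A least fixed
  point is the right notion because a play without end is lost. The list of Merlin's replies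
  describes the position: Arthur's next moves depend on nothing else, and Nimue's earlier choices
  have no effect on what may follow.
\<close>

inductive wins :: "T3_oracle \<Rightarrow> (nat \<Rightarrow> nat option) \<Rightarrow> nat \<Rightarrow> nat set \<Rightarrow> nat list \<Rightarrow> bool"
  for g \<alpha> m F where
  declare_value: "\<lbrakk> \<alpha> \<langle>m, list_encode vs\<rangle> = Some (2 * u); u \<in> F \<rbrakk> \<Longrightarrow> wins g \<alpha> m F vs"
| ask: "\<lbrakk> \<alpha> \<langle>m, list_encode vs\<rangle> = Some (Suc (2 * n)); G \<in> g n; \<forall>v\<in>G. wins g \<alpha> m F (vs @ [v]) \<rbrakk>
          \<Longrightarrow> wins g \<alpha> m F vs"

lemma arthur_move_Inl: "arthur_move \<alpha> m vs = Some (Inl u) \<longleftrightarrow> \<alpha> \<langle>m, list_encode vs\<rangle> = Some (2 * u)"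
  by (auto simp: arthur_move_def sum_decode_def)

lemma arthur_move_Inr:
  "arthur_move \<alpha> m vs = Some (Inr n) \<longleftrightarrow> \<alpha> \<langle>m, list_encode vs\<rangle> = Some (Suc (2 * n))"
  by (auto simp: arthur_move_def sum_decode_def split: if_splits intro!: exI[of _ "Suc (2 * n)"])

text \<open>
  At a position that is not winning, whatever Nimue does, Merlin has a reply that leads to another
  such position, unless the game is lost at once. By always choosing such replies he avoids losing
  against any Nimue.
\<close>

lemma wins_if_winning_pair:
  assumes "\<forall>w. \<exists>k. game_play g \<alpha> \<nu> m F w k = Won"
  shows "wins g \<alpha> m F []"
proof (rule ccontr)
  assume not: "\<not> wins g \<alpha> m F []"
  define bad where
    "bad s = (case s of Running ns vs \<Rightarrow> \<not> wins g \<alpha> m F vs | Won \<Rightarrow> False | Lost \<Rightarrow> True)" for s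
  have bad_step: "\<exists>v. bad (game_round g \<alpha> \<nu> m F v s)" if "bad s" for s
  proof (cases s)
    case (Running ns vs)
    then have nw: "\<not> wins g \<alpha> m F vs" using that by (simp add: bad_def)
    consider "arthur_move \<alpha> m vs = None" | u where "arthur_move \<alpha> m vs = Some (Inl u)"
      | n where "arthur_move \<alpha> m vs = Some (Inr n)"
      by (metis option.exhaust sum.exhaust)
    then show ?thesis
    proof cases
      case 1
      then show ?thesis by (simp add: Running bad_def)
    next
      case (2 u)
      then have "u \<notin> F" using nw wins.declare_value arthur_move_Inl by metis
      then show ?thesis using 2 by (simp add: Running bad_def)
    next
      case (3 n)
      define G where "G = \<nu> m F (ns @ [n]) vs"
      show ?thesis
      proof (cases "G \<in> g n")
        case True
        then obtain v where "v \<in> G" "\<not> wins g \<alpha> m F (vs @ [v])"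
          using nw wins.ask 3 arthur_move_Inr by metis
        then have "bad (game_round g \<alpha> \<nu> m F v s)"
          using 3 True unfolding G_def by (simp add: Running bad_def)
        then show ?thesis ..
      qed (simp add: 3 Running bad_def G_def)
    qed
  qed (use that in \<open>simp_all add: bad_def\<close>)
  define pick where "pick s = (SOME v. bad (game_round g \<alpha> \<nu> m F v s))" for s
  have pick: "bad (game_round g \<alpha> \<nu> m F (pick s) s)" if "bad s" for s
    unfolding pick_def using bad_step[OF that] by (rule someI_ex)
  define st where "st k = ((\<lambda>s. game_round g \<alpha> \<nu> m F (pick s) s) ^^ k) (Running [] [])" for k
  have "game_play g \<alpha> \<nu> m F (\<lambda>k. pick (st k)) k = st k" for k
    by (induction k) (simp_all add: st_def)
  moreover have "bad (st k)" for k
    by (induction k) (use not in \<open>simp_all add: st_def pick\<close>, simp add: bad_def)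
  ultimately have "game_play g \<alpha> \<nu> m F (\<lambda>k. pick (st k)) k \<noteq> Won" for k
    by (metis bad_def game_state.simps(9))
  then show False using assms by blast
qed

text \<open>
  Winning with a given strategy \<open>N\<close> for Nimue. It is not enough that \<open>N\<close> always moves to winning
  positions, because she could postpone the victory forever; so a strategy is put together along
  the well-founded definition of \<open>wins\<close>.
\<close>

inductive wins_with ::
  "T3_oracle \<Rightarrow> (nat \<Rightarrow> nat option) \<Rightarrow> nat \<Rightarrow> nat set \<Rightarrow> (nat list \<Rightarrow> nat set) \<Rightarrow> nat list \<Rightarrow> bool"
  for g \<alpha> m F N where
  declare_value: "\<lbrakk> \<alpha> \<langle>m, list_encode vs\<rangle> = Some (2 * u); u \<in> F \<rbrakk> \<Longrightarrow> wins_with g \<alpha> m F N vs"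
| ask: "\<lbrakk> \<alpha> \<langle>m, list_encode vs\<rangle> = Some (Suc (2 * n)); N vs \<in> g n;
           \<forall>v\<in>N vs. wins_with g \<alpha> m F N (vs @ [v]) \<rbrakk> \<Longrightarrow> wins_with g \<alpha> m F N vs"

lemma wins_with_cong:
  assumes "wins_with g \<alpha> m F N vs" "\<And>zs. N' (vs @ zs) = N (vs @ zs)"
  shows "wins_with g \<alpha> m F N' vs"
  using assms
proof induction
  case (ask vs n)
  have "N' vs = N vs" using ask.prems[of "[]"] by simp
  then show ?case using ask by (intro wins_with.ask[of _ _ _ n]) auto
qed (rule wins_with.declare_value)

lemma wins_with_if_wins:
  assumes "wins g \<alpha> m F vs"
  shows "\<exists>N. wins_with g \<alpha> m F N vs"
  using assms
proof induction
  case (declare_value vs u)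
  then show ?case using wins_with.declare_value by metis
next
  case (ask vs n G)
  then obtain N where N: "\<And>v. v \<in> G \<Longrightarrow> wins_with g \<alpha> m F (N v) (vs @ [v])" by metis
  \<comment> \<open>Below \<open>vs @ [v]\<close> use the strategy \<open>N v\<close>; the entry of \<open>xs\<close> at the place \<open>length vs\<close> is this \<open>v\<close>.\<close>
  define N' where "N' xs = (if xs = vs then G else N (xs ! length vs) xs)" for xs
  have "wins_with g \<alpha> m F N' (vs @ [v])" if "v \<in> G" for v
    using N[OF that] by (rule wins_with_cong) (simp add: N'_def)
  moreover have "N' vs = G" by (simp add: N'_def)
  ultimately have "wins_with g \<alpha> m F N' vs"
    using ask by (intro wins_with.ask[of _ _ _ n]) auto
  then show ?case by blast
qed

lemma game_play_if_wins_with: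
  assumes "wins_with g \<alpha> m F N vs" "\<And>ns vs. \<nu> m F ns vs = N vs"
    and "game_play g \<alpha> \<nu> m F w k = Running ns vs"
  shows "\<exists>k. game_play g \<alpha> \<nu> m F w k = Won"
  using assms(1,3)
proof (induction arbitrary: k ns)
  case (declare_value vs u)
  then have "game_play g \<alpha> \<nu> m F w (Suc k) = Won"
    using arthur_move_Inl[of \<alpha> m vs u] by simp
  then show ?case ..
next
  case (ask vs n)
  then have next_state: "game_play g \<alpha> \<nu> m F w (Suc k) =
      (if w k \<notin> N vs then Won else Running (ns @ [n]) (vs @ [w k]))"
    using arthur_move_Inr[of \<alpha> m vs n] assms(2) by simp
  show ?case
  proof (cases "w k \<in> N vs")
    case True
    then have "game_play g \<alpha> \<nu> m F w (Suc k) = Running (ns @ [n]) (vs @ [w k])"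
      using next_state by simp
    then show ?thesis using ask.IH True by blast
  next
    case False
    then show ?thesis using next_state by metis
  qed
qed

text \<open>
  The winning positions absorb Nimue's strategy: to prove a reduction it remains to give Arthur's
  partial computable function, and to refute one it remains to examine his moves.
\<close>

theorem T3_reducible_iff_wins:
  "T3_reducible f g \<longleftrightarrow> (\<exists>\<alpha>. partial_computable \<alpha> \<and> (\<forall>m. \<forall>F\<in>f m. wins g \<alpha> m F []))"
proof
  assume "T3_reducible f g"
  then show "\<exists>\<alpha>. partial_computable \<alpha> \<and> (\<forall>m. \<forall>F\<in>f m. wins g \<alpha> m F [])"
    unfolding T3_reducible_def winning_pair_def using wins_if_winning_pair by blast
next
  assume "\<exists>\<alpha>. partial_computable \<alpha> \<and> (\<forall>m. \<forall>F\<in>f m. wins g \<alpha> m F [])"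
  then obtain \<alpha> where \<alpha>: "partial_computable \<alpha>" "\<And>m F. F \<in> f m \<Longrightarrow> wins g \<alpha> m F []"
    by blast
  then have "\<forall>m F. \<exists>N. F \<in> f m \<longrightarrow> wins_with g \<alpha> m F N []"
    using wins_with_if_wins by blast
  then obtain N where N: "\<And>m F. F \<in> f m \<Longrightarrow> wins_with g \<alpha> m F (N m F) []"
    by metis
  have "\<exists>k. game_play g \<alpha> (\<lambda>m F ns vs. N m F vs) m F w k = Won" if "F \<in> f m" for m F w
    by (rule game_play_if_wins_with[OF N[OF that], where k = 0 and ns = "[]"]) simp_all
  then have "winning_pair f g \<alpha> (\<lambda>m F ns vs. N m F vs)"
    unfolding winning_pair_def by blast
  then show "T3_reducible f g" using \<alpha>(1) unfolding T3_reducible_def by blast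
qed

section \<open>Reducibility is a preorder\<close>

text \<open>
  Arthur asks the oracle about his own input \<open>m\<close>, Nimue hands on the set \<open>F\<close>, and Arthur declares
  what Merlin took from it.
\<close>

lemma T3_reducible_refl: "T3_reducible f f"
proof -
  define \<alpha> where "\<alpha> x = Some (if pi2 x = 0 then Suc (2 * pi1 x) else 2 * pi1 (pi2 x - 1))" for x
  have "partial_computable \<alpha>"
    unfolding \<alpha>_def partial_computable_Some_iff by (intro computable_intros)
  moreover have "wins f \<alpha> m F []" if "F \<in> f m" for m F
  proof (rule wins.ask[where g = f and n = m, OF _ that])
    show "\<forall>v\<in>F. wins f \<alpha> m F ([] @ [v])"
      by (auto simp: \<alpha>_def intro!: wins.declare_value)
  qed (simp add: \<alpha>_def)
  ultimately show ?thesis unfolding T3_reducible_iff_wins by blast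
qed

text \<open>
  The output of a machine with transition relation \<open>step\<close> and output relation \<open>halt\<close>.
\<close>

inductive result :: "(nat \<Rightarrow> nat \<Rightarrow> bool) \<Rightarrow> (nat \<Rightarrow> nat \<Rightarrow> bool) \<Rightarrow> nat \<Rightarrow> nat \<Rightarrow> bool"
  for step halt where
  halt: "halt c y \<Longrightarrow> result step halt c y"
| step: "step c c' \<Longrightarrow> result step halt c' y \<Longrightarrow> result step halt c y"

lemma semidecidable_result:
  assumes step: "semidecidable (\<lambda>w. step (pi1 w) (pi2 w))"
    and halt: "semidecidable (\<lambda>w. halt (pi1 w) (pi2 w))"
  shows "semidecidable (\<lambda>w. result step halt (pi1 w) (pi2 w))"
proof -
  define R where "R a b c \<longleftrightarrow> (\<exists>c1 c2 y. a = \<langle>c2, y\<rangle> \<and> c = \<langle>c1, y\<rangle> \<and> step c1 c2)"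
    for a b c :: nat
  define X where "X c \<longleftrightarrow> halt (pi1 c) (pi2 c)" for c
  have iff: "derivable X R w \<longleftrightarrow> result step halt (pi1 w) (pi2 w)" for w
  proof
    assume "derivable X R w"
    then show "result step halt (pi1 w) (pi2 w)"
      by induction (auto simp: X_def R_def intro: result.intros)
  next
    have "derivable X R \<langle>c, y\<rangle>" if "result step halt c y" for c y
      using that
    proof induction
      case (halt c y)
      then show ?case by (intro derivable.base) (simp add: X_def)
    next
      case (step c c' y)
      from step.IH step.IH show ?case
        by (rule derivable.infer) (use step.hyps in \<open>auto simp: R_def\<close>)
    qed
    then show "result step halt (pi1 w) (pi2 w) \<Longrightarrow> derivable X R w"
      by (metis pair_pi)
  qed
  have "semidecidable (\<lambda>w. step (f w) (g w))"
    if "computable_fun f" "computable_fun g" for f g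
    using semidecidable_vimage[OF step computable_pair[OF that]] by simp
  note this [semidecidable_intros]
  have "semidecidable (derivable X R)"
  proof (rule semidecidable_derivable)
    show "semidecidable X" unfolding X_def by (rule halt)
    show "semidecidable (\<lambda>w. R (pi1 w) (pi1 (pi2 w)) (pi2 (pi2 w)))"
      unfolding R_def by (intro semidecidable_intros computable_intros)
  qed
  moreover have "derivable X R = (\<lambda>w. result step halt (pi1 w) (pi2 w))"
    by (rule ext) (rule iff)
  ultimately show ?thesis by simp
qed

lemma result_step_iff:
  assumes "step c c'" "\<And>d. step c d \<Longrightarrow> d = c'" "\<And>y. \<not> halt c y"
  shows "result step halt c y \<longleftrightarrow> result step halt c' y"
  using assms by (subst result.simps) blast

lemma result_deterministic:
  assumes "\<And>c d e. step c d \<Longrightarrow> step c e \<Longrightarrow> d = e" "\<And>c y z. halt c y \<Longrightarrow> halt c z \<Longrightarrow> y = z"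
    and "\<And>c d y. step c d \<Longrightarrow> \<not> halt c y"
    and "result step halt c y" "result step halt c z"
  shows "y = z"
  using assms(4,5)
proof induction
  case (halt c y)
  from halt(2,1) show ?case by cases (use assms(2,3) in blast)+
next
  case (step c c' y)
  from step.prems step.hyps(1) have "result step halt c' z"
    by cases (use assms(1,3) in blast)+
  then show ?case by (rule step.IH)
qed

text \<open>
  The composition of a strategy \<open>\<alpha>\<close>, which asks the oracle \<open>g\<close>, with a strategy \<open>\<beta>\<close>, which answers
  questions about \<open>g\<close> by asking \<open>h\<close>, is described by a machine that replays the game from the list
  of replies of the player of \<open>h\<close>. In \<open>outer_code m s r\<close> the strategy \<open>\<alpha>\<close> is to move, on input \<open>m\<close>
  and after the answers \<open>s\<close>; in \<open>inner_code m s n t r\<close> it has asked \<open>n\<close>, and \<open>\<beta>\<close> is to move, on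
  input \<open>n\<close> and after the replies \<open>t\<close>. The list \<open>r\<close> contains the replies not used so far. The
  machine halts when \<open>\<alpha>\<close> declares a value or when \<open>\<beta>\<close> asks a question for which no reply is left;
  this is the move of the composite strategy.
\<close>

abbreviation outer_code :: "nat \<Rightarrow> nat \<Rightarrow> nat \<Rightarrow> nat" where
  "outer_code m s r \<equiv> \<langle>0, \<langle>m, \<langle>s, r\<rangle>\<rangle>\<rangle>"

abbreviation inner_code :: "nat \<Rightarrow> nat \<Rightarrow> nat \<Rightarrow> nat \<Rightarrow> nat \<Rightarrow> nat" where
  "inner_code m s n t r \<equiv> \<langle>1, \<langle>m, \<langle>s, \<langle>n, \<langle>t, r\<rangle>\<rangle>\<rangle>\<rangle>\<rangle>"

definition compose_step ::
  "(nat \<Rightarrow> nat option) \<Rightarrow> (nat \<Rightarrow> nat option) \<Rightarrow> nat \<Rightarrow> nat \<Rightarrow> bool" where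
  "compose_step \<alpha> \<beta> c c' \<longleftrightarrow>
     (\<exists>m s r n. c = outer_code m s r \<and> c' = inner_code m s n 0 r \<and>
        \<alpha> \<langle>m, s\<rangle> = Some (Suc (2 * n))) \<or>
     (\<exists>m s n t r u. c = inner_code m s n t r \<and> c' = outer_code m (snoc_code s u) r \<and>
        \<beta> \<langle>n, t\<rangle> = Some (2 * u)) \<or>
     (\<exists>m s n t r v k. c = inner_code m s n t (Suc \<langle>v, r\<rangle>) \<and>
        c' = inner_code m s n (snoc_code t v) r \<and> \<beta> \<langle>n, t\<rangle> = Some (Suc (2 * k)))"

definition compose_halt ::
  "(nat \<Rightarrow> nat option) \<Rightarrow> (nat \<Rightarrow> nat option) \<Rightarrow> nat \<Rightarrow> nat \<Rightarrow> bool" where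
  "compose_halt \<alpha> \<beta> c y \<longleftrightarrow>
     (\<exists>m s r u. c = outer_code m s r \<and> y = 2 * u \<and> \<alpha> \<langle>m, s\<rangle> = Some (2 * u)) \<or>
     (\<exists>m s n t k. c = inner_code m s n t 0 \<and> y = Suc (2 * k) \<and> \<beta> \<langle>n, t\<rangle> = Some (Suc (2 * k)))"

lemma Suc_double_neq_double: "Suc (2 * k) \<noteq> 2 * l" "2 * l \<noteq> Suc (2 * k)"
  by presburger+

lemma compose_deterministic:
  "compose_step \<alpha> \<beta> c d \<Longrightarrow> compose_step \<alpha> \<beta> c e \<Longrightarrow> d = e"
  "compose_halt \<alpha> \<beta> c y \<Longrightarrow> compose_halt \<alpha> \<beta> c z \<Longrightarrow> y = z"
  "compose_step \<alpha> \<beta> c d \<Longrightarrow> \<not> compose_halt \<alpha> \<beta> c y"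
  unfolding compose_step_def compose_halt_def
  by (elim disjE exE conjE; simp add: Suc_double_neq_double)+

lemma semidecidable_compose:
  assumes "partial_computable \<alpha>" "partial_computable \<beta>"
  shows "semidecidable (\<lambda>w. compose_step \<alpha> \<beta> (pi1 w) (pi2 w))"
    "semidecidable (\<lambda>w. compose_halt \<alpha> \<beta> (pi1 w) (pi2 w))"
  unfolding compose_step_def compose_halt_def
  by (intro semidecidable_intros computable_intros
      semidecidable_partial_computable[OF assms(1)] semidecidable_partial_computable[OF assms(2)])+

text \<open>
  Nimue's side of the composition is a nested induction: over the winning positions of \<open>\<alpha>\<close> and, at
  each question of \<open>\<alpha>\<close>, over the winning positions of \<open>\<beta>\<close> for the set that Nimue would have chosen.
  Thus each value that \<open>\<beta>\<close> declares is a possible reply of Merlin to \<open>\<alpha>\<close>.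
\<close>

lemma T3_reducible_trans:
  assumes "T3_reducible f g" "T3_reducible g h"
  shows "T3_reducible f h"
proof -
  from assms obtain \<alpha> \<beta> where \<alpha>: "partial_computable \<alpha>" "\<And>m F. F \<in> f m \<Longrightarrow> wins g \<alpha> m F []"
    and \<beta>: "partial_computable \<beta>" "\<And>n G. G \<in> g n \<Longrightarrow> wins h \<beta> n G []"
    unfolding T3_reducible_iff_wins by blast
  let ?res = "result (compose_step \<alpha> \<beta>) (compose_halt \<alpha> \<beta>)"
  have det: "?res c y \<Longrightarrow> ?res c z \<Longrightarrow> y = z" for c y z
    by (rule result_deterministic[OF compose_deterministic])
  have step: "?res c y \<longleftrightarrow> ?res c' y" if "compose_step \<alpha> \<beta> c c'" for c c' y
    using that compose_deterministic by (intro result_step_iff) blast+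
  have "semidecidable (\<lambda>w. ?res (pi1 w) (pi2 w))"
    by (intro semidecidable_result semidecidable_compose \<alpha>(1) \<beta>(1))
  then have "semidecidable (\<lambda>w. ?res (pi1 (f w)) (pi2 (f w)))" if "computable_fun f" for f
    using that by (rule semidecidable_vimage)
  from this[of "\<lambda>w. \<langle>outer_code (pi1 (pi1 w)) 0 (pi2 (pi1 w)), pi2 w\<rangle>"]
  have "semidecidable (\<lambda>w. ?res (outer_code (pi1 (pi1 w)) 0 (pi2 (pi1 w))) (pi2 w))"
    by (simp add: computable_intros)
  then have "\<exists>\<gamma>. partial_computable \<gamma> \<and>
      (\<forall>x y. \<gamma> x = Some y \<longleftrightarrow> ?res (outer_code (pi1 x) 0 (pi2 x)) y)"
    by (rule partial_computable_if_single_valued) (erule (1) det)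
  then obtain \<gamma> where \<gamma>: "partial_computable \<gamma>"
    "\<And>x y. \<gamma> x = Some y \<longleftrightarrow> ?res (outer_code (pi1 x) 0 (pi2 x)) y"
    by blast
  define start where "start m vs = outer_code m 0 (list_encode vs)" for m vs
  have \<gamma>_iff: "\<gamma> \<langle>m, list_encode vs\<rangle> = Some y \<longleftrightarrow> ?res (start m vs) y" for m vs y
    unfolding \<gamma>(2) start_def by simp
  \<comment> \<open>After the replies \<open>vs\<close>, the simulation is at the configuration \<open>c\<close>, awaiting further replies.\<close>
  define reached where "reached m vs c \<longleftrightarrow>
    (\<forall>r y. ?res (start m (vs @ r)) y \<longleftrightarrow> ?res (c (list_encode r)) y)" for m vs c
  have reached_step: "reached m (vs @ ws) c'"
    if "reached m vs c" "\<And>r. compose_step \<alpha> \<beta> (c (list_encode (ws @ r))) (c' (list_encode r))"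
    for m vs ws c c'
    using that(1) step[OF that(2)] unfolding reached_def by simp
  have \<gamma>_halt: "\<gamma> \<langle>m, list_encode vs\<rangle> = Some y"
    if "reached m vs c" "compose_halt \<alpha> \<beta> (c 0) y" for m vs c y
    using that(1)[unfolded reached_def, rule_format, of "[]"] that(2)
    unfolding \<gamma>_iff by (simp add: result.halt)
  let ?outer = "\<lambda>m s. outer_code m (list_encode s)"
  let ?inner = "\<lambda>m s n t. inner_code m (list_encode s) n (list_encode t)"
  have inner: "wins h \<gamma> m F vs"
    if "wins h \<beta> n G t" "\<forall>u\<in>G. \<forall>vs. reached m vs (?outer m (s @ [u])) \<longrightarrow> wins h \<gamma> m F vs"
      "reached m vs (?inner m s n t)"
    for m F n G s t vs
    using that
  proof (induction arbitrary: vs)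
    case (declare_value t u)
    have "compose_step \<alpha> \<beta> (?inner m s n t r) (?outer m (s @ [u]) r)" for r
      unfolding compose_step_def using declare_value.hyps(1)
      by (metis snoc_code_list_encode)
    then have "reached m (vs @ []) (?outer m (s @ [u]))"
      by (intro reached_step[OF declare_value.prems(2)]) simp
    then show ?case using declare_value.prems(1) declare_value.hyps(2) by simp
  next
    case (ask t k G')
    have "compose_halt \<alpha> \<beta> (?inner m s n t 0) (Suc (2 * k))"
      unfolding compose_halt_def using ask.hyps(1) by blast
    then have "\<gamma> \<langle>m, list_encode vs\<rangle> = Some (Suc (2 * k))"
      by (rule \<gamma>_halt[OF ask.prems(2)])
    moreover have "wins h \<gamma> m F (vs @ [v])" if "v \<in> G'" for v
    proof -
      have "compose_step \<alpha> \<beta> (?inner m s n t (Suc \<langle>v, r\<rangle>)) (?inner m s n (t @ [v]) r)" for r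
        unfolding compose_step_def using ask.hyps(1) by (metis snoc_code_list_encode)
      then have "reached m (vs @ [v]) (?inner m s n (t @ [v]))"
        by (intro reached_step[OF ask.prems(2)]) simp
      then show ?thesis using ask.IH ask.prems(1) that by blast
    qed
    ultimately show ?case using ask.hyps(2) by (intro wins.ask[where n = k and G = G']) auto
  qed
  have outer: "wins h \<gamma> m F vs" if "wins g \<alpha> m F s" "reached m vs (?outer m s)" for m F s vs
    using that
  proof (induction arbitrary: vs)
    case (declare_value s u)
    have "compose_halt \<alpha> \<beta> (?outer m s 0) (2 * u)"
      unfolding compose_halt_def using declare_value.hyps(1) by blast
    then have "\<gamma> \<langle>m, list_encode vs\<rangle> = Some (2 * u)"
      by (rule \<gamma>_halt[OF declare_value.prems])
    then show ?case using declare_value.hyps(2) by (rule wins.declare_value)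
  next
    case (ask s n G)
    have "compose_step \<alpha> \<beta> (?outer m s r) (?inner m s n [] r)" for r
      unfolding compose_step_def list_encode.simps(1) using ask.hyps(1) by blast
    then have "reached m (vs @ []) (?inner m s n [])"
      by (intro reached_step[OF ask.prems]) simp
    moreover have "\<forall>u\<in>G. \<forall>vs. reached m vs (?outer m (s @ [u])) \<longrightarrow> wins h \<gamma> m F vs"
      using ask.IH by blast
    ultimately show ?case using inner[OF \<beta>(2)[OF ask.hyps(2)]] by simp
  qed
  have "wins h \<gamma> m F []" if "F \<in> f m" for m F
    by (rule outer[OF \<alpha>(2)[OF that]]) (simp add: start_def reached_def)
  then show ?thesis using \<gamma>(1) unfolding T3_reducible_iff_wins by blast
qed

lemma T3_deg_eq_iff: "T3_deg f = T3_deg g \<longleftrightarrow> T3_reducible f g \<and> T3_reducible g f"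
proof
  assume "T3_deg f = T3_deg g"
  moreover have "f \<in> T3_deg f" by (simp add: T3_deg_def T3_reducible_refl)
  ultimately have "f \<in> T3_deg g" by simp
  then show "T3_reducible f g \<and> T3_reducible g f" by (simp add: T3_deg_def)
next
  assume "T3_reducible f g \<and> T3_reducible g f"
  then show "T3_deg f = T3_deg g"
    unfolding T3_deg_def using T3_reducible_trans by blast
qed

lemma deg_le_iff: "T3_deg f \<le>\<^sub>T\<^sub>3 T3_deg g \<longleftrightarrow> T3_reducible f g"
  unfolding deg_le_def T3_deg_def using T3_reducible_refl T3_reducible_trans by blast

section \<open>Total oracles below coding degrees\<close>

lemma T3_of_T0_apply: "T3_of_T0 f n = {{f n}}"
  by (simp add: T3_of_T0_def T3_of_T2_def T2_of_T1_def T1_of_T0_def)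

text \<open>
  The four replies of Merlin: indices of the constant programs with values \<open>0\<close> and \<open>1\<close>, and of the
  programs that return \<open>A(n)\<close> and \<open>1 - A(n)\<close> when the oracle is \<open>A\<close>.
\<close>

primrec const_prog :: "nat \<Rightarrow> prog" where
  "const_prog 0 = PZero"
| "const_prog (Suc n) = PComp PSucc (const_prog n)"

definition ask_prog :: "nat \<Rightarrow> prog" where
  "ask_prog n = PComp POracle (const_prog n)"

definition ask_not_prog :: "nat \<Rightarrow> prog" where
  "ask_not_prog n = PComp (PRec (PComp PSucc PZero) PZero) (PPair PZero (ask_prog n))"

lemma computes_const_prog: "computes A (const_prog n) x n"
  by (induction n) (auto intro: computes.intros)

lemma computes_ask_prog: "computes A (ask_prog n) x (charf A n)"
  unfolding ask_prog_def by (rule computes.comp[OF computes_const_prog computes.query])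

lemma computes_ask_not_prog: "computes A (ask_not_prog n) x (1 - charf A n)"
proof -
  let ?not = "PRec (PComp PSucc PZero) PZero"
  have 0: "computes A ?not \<langle>0, 0\<rangle> (Suc 0)"
    by (intro computes.rec_0 computes.comp[OF computes.zero computes.succ])
  have "computes A ?not \<langle>0, Suc 0\<rangle> 0"
    by (rule computes.rec_Suc[OF 0 computes.zero])
  with 0 have "computes A ?not \<langle>0, charf A n\<rangle> (1 - charf A n)"
    by (simp add: charf_def)
  then show ?thesis
    unfolding ask_not_prog_def
    by (intro computes.comp[OF computes.pair[OF computes.zero computes_ask_prog]])
qed

text \<open>
  Under the hypothesis \<open>A(n) = i\<close>, both \<open>fixed_move b\<close> and \<open>bit_move n i b\<close> belong to \<open>H b A\<close>. Every
  number other than \<open>0\<close> stands for the bit \<open>1\<close>.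
\<close>

definition fixed_move :: "nat \<Rightarrow> nat" where
  "fixed_move b = (if b = 0 then prog_code (const_prog 0) else prog_code (const_prog 1))"

definition bit_move :: "nat \<Rightarrow> nat \<Rightarrow> nat \<Rightarrow> nat" where
  "bit_move n i b = (if b = 0 then if i = 0 then prog_code (ask_prog n) else prog_code (ask_not_prog n)
     else if i = 0 then prog_code (ask_not_prog n) else prog_code (ask_prog n))"

lemma mem_H: "computes A p 0 i \<Longrightarrow> prog_code p \<in> H i A"
  by (simp add: H_def phi_prog_code)

lemma fixed_move_mem: "b < 2 \<Longrightarrow> fixed_move b \<in> H b A"
  unfolding fixed_move_def using mem_H[OF computes_const_prog, of b A] by (auto simp: less_2_cases_iff)

lemma bit_move_mem:
  assumes "b < 2"
  shows "bit_move n (charf A n) b \<in> H b A"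
proof -
  have "prog_code (ask_prog n) \<in> H (charf A n) A" "prog_code (ask_not_prog n) \<in> H (1 - charf A n) A"
    by (intro mem_H computes_ask_prog computes_ask_not_prog)+
  then show ?thesis using assms
    by (cases "n \<in> A") (auto simp: charf_def bit_move_def less_2_cases_iff)
qed

lemma computable_fixed_move: "computable_fun fixed_move"
  unfolding fixed_move_def by (intro computable_intros)

lemma computable_bit_move [computable_intros]:
  assumes "computable_fun n" "computable_fun i" "computable_fun b"
  shows "computable_fun (\<lambda>x. bit_move (n x) (i x) (b x))"
proof -
  have "prog_code (const_prog k) = rec_nat 0 (\<lambda>_ c. 6 + 4 * \<langle>1, c\<rangle>) k" for k
    by (induction k) simp_all
  moreover have "computable_fun (\<lambda>x. rec_nat 0 (\<lambda>_ c. 6 + 4 * \<langle>1, c\<rangle>) (n x))"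
    by (intro computable_intros assms)
  ultimately have const: "computable_fun (\<lambda>x. prog_code (const_prog (n x)))"
    by simp
  then have ask: "computable_fun (\<lambda>x. prog_code (ask_prog (n x)))"
    unfolding ask_prog_def prog_code.simps by (intro computable_intros)
  then have ask_not: "computable_fun (\<lambda>x. prog_code (ask_not_prog (n x)))"
    unfolding ask_not_prog_def prog_code.simps by (intro computable_intros)
  show ?thesis unfolding bit_move_def
    by (intro computable_intros assms ask ask_not)
qed

text \<open>
  Arthur's question \<open>q\<close> does not influence a basic oracle; the premise about it only ensures that he
  has not declared a value yet, so that the ends of a tree are determined by \<open>\<alpha>\<close>.
\<close>

inductive forces :: "(nat \<Rightarrow> nat option) \<Rightarrow> nat \<Rightarrow> nat \<Rightarrow> nat \<Rightarrow> nat \<Rightarrow> nat \<Rightarrow> bool"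
  for \<alpha> m n i u where
  leaf: "\<alpha> \<langle>m, s\<rangle> = Some (2 * u) \<Longrightarrow> forces \<alpha> m n i u s"
| node: "\<lbrakk> \<alpha> \<langle>m, s\<rangle> = Some (Suc (2 * q)); forces \<alpha> m n i u (snoc_code s (fixed_move b));
           forces \<alpha> m n i u (snoc_code s (bit_move n i b)) \<rbrakk> \<Longrightarrow> forces \<alpha> m n i u s"

text \<open>
  Restrict a winning tree to the replies \<open>fixed_move b\<close> and \<open>bit_move n (charf A n) b\<close>, which are
  legal whenever Nimue chooses \<open>H b A\<close>.
\<close>

lemma forces_if_wins:
  assumes "wins (T3_of_basic {H 0 A, H 1 A}) \<alpha> m {u} vs"
  shows "forces \<alpha> m n (charf A n) u (list_encode vs)"
  using assms
proof induction
  case (declare_value vs u')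
  then show ?case by (intro forces.leaf) simp
next
  case (ask vs q G)
  then have "G = H 0 A \<or> G = H 1 A" by (simp add: T3_of_basic_def)
  then obtain b where b: "b < 2" "G = H b A"
    using that[of 0] that[of 1] by auto
  show ?case
  proof (rule forces.node)
    show "\<alpha> \<langle>m, list_encode vs\<rangle> = Some (Suc (2 * q))" by (rule ask.hyps(1))
    show "forces \<alpha> m n (charf A n) u (snoc_code (list_encode vs) (fixed_move b))"
      using ask.IH fixed_move_mem[OF b(1)] b(2) by simp
    show "forces \<alpha> m n (charf A n) u (snoc_code (list_encode vs) (bit_move n (charf A n) b))"
      using ask.IH bit_move_mem[OF b(1)] b(2) by simp
  qed
qed

text \<open>
  Two trees for opposite hypotheses share a branch. At each node, equal bits have the fixed reply in
  common; for unequal bits both arguments of \<open>bit_move\<close> change, and the reply remains the same.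
\<close>

lemma forces_opposite_agree:
  assumes "forces \<alpha> m n i u s" "forces \<alpha> m n i' u' s" "i = 0 \<longleftrightarrow> i' \<noteq> 0"
  shows "u = u'"
  using assms(1,2)
proof induction
  case (leaf s)
  from leaf(2,1) show ?case by cases (auto simp: Suc_double_neq_double)
next
  case (node s q b)
  from node.prems node.hyps(1) show ?case
  proof cases
    case (node q' b')
    show ?thesis
    proof (cases "b = 0 \<longleftrightarrow> b' = 0")
      case True
      then have "fixed_move b = fixed_move b'" by (simp add: fixed_move_def)
      then show ?thesis using node(2) \<open>forces _ _ _ _ u' (snoc_code s (fixed_move b)) \<Longrightarrow> u = u'\<close> by simp
    next
      case False
      then have "bit_move n i b = bit_move n i' b'" using assms(3) by (auto simp: bit_move_def)
      then show ?thesis using node(3) \<open>forces _ _ _ _ u' (snoc_code s (bit_move n i b)) \<Longrightarrow> u = u'\<close> by simp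
    qed
  qed (auto simp: Suc_double_neq_double)
qed

abbreviation forces_code :: "nat \<Rightarrow> nat \<Rightarrow> nat \<Rightarrow> nat \<Rightarrow> nat \<Rightarrow> nat" where
  "forces_code m n i u s \<equiv> \<langle>m, \<langle>n, \<langle>i, \<langle>u, s\<rangle>\<rangle>\<rangle>\<rangle>"

lemma semidecidable_forces:
  assumes \<alpha>: "partial_computable \<alpha>"
    and "computable_fun m" "computable_fun n" "computable_fun i" "computable_fun u" "computable_fun s"
  shows "semidecidable (\<lambda>x. forces \<alpha> (m x) (n x) (i x) (u x) (s x))"
proof -
  define X where "X c \<longleftrightarrow> (\<exists>m n i u s. c = forces_code m n i u s \<and> \<alpha> \<langle>m, s\<rangle> = Some (2 * u))" for c
  define R where "R a b c \<longleftrightarrow> (\<exists>m n i u s k q. a = forces_code m n i u (snoc_code s (fixed_move k)) \<and>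
      b = forces_code m n i u (snoc_code s (bit_move n i k)) \<and> c = forces_code m n i u s \<and>
      \<alpha> \<langle>m, s\<rangle> = Some (Suc (2 * q)))" for a b c
  have sound: "\<forall>m n i u s. c = forces_code m n i u s \<longrightarrow> forces \<alpha> m n i u s" if "derivable X R c" for c
    using that
  proof induction
    case (base c)
    then show ?case by (auto simp: X_def intro: forces.leaf)
  next
    case (infer a b c)
    from infer.hyps(3) infer.IH show ?case unfolding R_def
      by (elim exE conjE) (simp, blast intro: forces.node)
  qed
  have complete: "derivable X R (forces_code m n i u s)" if "forces \<alpha> m n i u s" for m n i u s
    using that
  proof induction
    case (leaf s)
    then show ?case by (intro derivable.base) (auto simp: X_def)
  next
    case (node s q b)
    from node.IH show ?case by (rule derivable.infer) (use node.hyps(1) in \<open>auto simp: R_def\<close>)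
  qed
  have "semidecidable X"
    unfolding X_def
    by (intro semidecidable_intros computable_intros semidecidable_partial_computable[OF \<alpha>])
  moreover have "semidecidable (\<lambda>w. R (pi1 w) (pi1 (pi2 w)) (pi2 (pi2 w)))"
    unfolding R_def
    by (intro semidecidable_intros computable_intros semidecidable_partial_computable[OF \<alpha>]
        computable_comp[OF computable_fixed_move])
  ultimately have "semidecidable (derivable X R)" by (rule semidecidable_derivable)
  then have "semidecidable (\<lambda>x. derivable X R (forces_code (m x) (n x) (i x) (u x) (s x)))"
    by (rule semidecidable_vimage) (intro computable_intros assms)
  moreover have "derivable X R (forces_code m n i u s) \<longleftrightarrow> forces \<alpha> m n i u s" for m n i u s
    using sound complete by blast
  ultimately show ?thesis by simp
qed

text \<open>
  The case distinction is whether for every input some bit of \<open>A\<close> is irrelevant, in the sense that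
  both hypotheses about it force the same value. It is not effective: in the second case the
  algorithm for \<open>A\<close> contains the number \<open>f m\<close> for an exceptional \<open>m\<close>.
\<close>

theorem computable_if_below_coding:
  assumes "T3_reducible (T3_of_T0 f) (T3_of_basic {H 0 A, H 1 A})"
  shows "computable_set A \<or> computable_fun f"
proof -
  from assms obtain \<alpha> where \<alpha>: "partial_computable \<alpha>"
    and wins: "\<And>m. wins (T3_of_basic {H 0 A, H 1 A}) \<alpha> m {f m} []"
    unfolding T3_reducible_iff_wins T3_of_T0_apply by auto
  let ?E = "\<lambda>m n i u. forces \<alpha> m n i u 0"
  have true_forced: "?E m n (charf A n) (f m)" for m n
    using forces_if_wins[OF wins, of m n] by simp
  have charf: "charf A n = 0 \<or> charf A n = 1" for n by (simp add: charf_def)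
  show ?thesis
  proof (cases "\<forall>m. \<exists>n u. ?E m n 0 u \<and> ?E m n 1 u")
    case True
    \<comment> \<open>The false hypothesis forces \<open>u\<close> and the true one forces \<open>f m\<close>.\<close>
    have "u = f m" if "?E m n 0 u" "?E m n 1 u" for m n u
      using charf[of n] true_forced[of m n] that forces_opposite_agree[of \<alpha> m n _ u 0 _ "f m"]
      by (metis zero_neq_one)
    then have "(\<exists>n. ?E m n 0 u \<and> ?E m n 1 u) \<longleftrightarrow> f m = u" for m u
      using True by metis
    moreover have "semidecidable (\<lambda>w. \<exists>n. ?E (pi1 w) n 0 (pi2 w) \<and> ?E (pi1 w) n 1 (pi2 w))"
      by (intro semidecidable_intros semidecidable_forces[OF \<alpha>] computable_intros)
    ultimately have "partial_computable (\<lambda>m. Some (f m))"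
      by (intro partial_computable_if_semidecidable_graph) simp
    then show ?thesis unfolding partial_computable_Some_iff ..
  next
    case False
    then obtain m where m: "\<And>n u. \<not> (?E m n 0 u \<and> ?E m n 1 u)" by blast
    \<comment> \<open>For this \<open>m\<close> only the true hypothesis forces \<open>f m\<close>.\<close>
    have "(i = 0 \<and> ?E m n 0 (f m) \<or> i = 1 \<and> ?E m n 1 (f m)) \<longleftrightarrow> charf A n = i" for n i
      using m[of n "f m"] true_forced[of m n] charf[of n] by auto
    moreover have "semidecidable (\<lambda>w. (pi2 w = 0 \<and> ?E m (pi1 w) 0 (f m)) \<or> (pi2 w = 1 \<and> ?E m (pi1 w) 1 (f m)))"
      by (intro semidecidable_intros semidecidable_forces[OF \<alpha>] computable_intros)
    ultimately have "partial_computable (\<lambda>n. Some (charf A n))"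
      by (intro partial_computable_if_semidecidable_graph) simp
    then show ?thesis unfolding computable_set_def ..
  qed
qed

lemma computable_reducible:
  assumes "computable_fun f"
  shows "T3_reducible (T3_of_T0 f) g"
proof -
  define \<alpha> where "\<alpha> x = Some (2 * f (pi1 x))" for x
  have "partial_computable \<alpha>"
    unfolding \<alpha>_def partial_computable_Some_iff
    by (intro computable_intros computable_comp[OF assms])
  moreover have "wins g \<alpha> m {f m} []" for m
    by (intro wins.declare_value[where u = "f m"]) (simp_all add: \<alpha>_def)
  ultimately show ?thesis unfolding T3_reducible_iff_wins T3_of_T0_apply by auto
qed

text \<open>
  Arthur asks an arbitrary question; Nimue chooses \<open>H (charf B m) A\<close>, and whichever element of it
  Merlin names, running this program with oracle \<open>A\<close> on input \<open>0\<close> yields \<open>charf B m\<close>.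
\<close>

lemma reducible_to_computable_coding:
  assumes "computable_set A"
  shows "T3_reducible (T3_of_T0 (charf B)) (T3_of_basic {H 0 A, H 1 A})"
proof -
  define P where "P x y \<longleftrightarrow> (\<exists>m. x = \<langle>m, 0\<rangle> \<and> y = 1) \<or>
    (\<exists>m e u. x = \<langle>m, Suc \<langle>e, 0\<rangle>\<rangle> \<and> y = 2 * u \<and> phi A e 0 = Some u)" for x y
  have "semidecidable (\<lambda>w. P (pi1 w) (pi2 w))"
    unfolding P_def by (intro semidecidable_intros computable_intros semidecidable_phi[OF assms])
  then have "\<exists>\<alpha>. partial_computable \<alpha> \<and> (\<forall>x y. \<alpha> x = Some y \<longleftrightarrow> P x y)"
    by (rule partial_computable_if_single_valued) (auto simp: P_def)
  then obtain \<alpha> where \<alpha>: "partial_computable \<alpha>" "\<And>x y. \<alpha> x = Some y \<longleftrightarrow> P x y"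
    by blast
  have "wins (T3_of_basic {H 0 A, H 1 A}) \<alpha> m {charf B m} []" for m
  proof (rule wins.ask[where n = 0 and G = "H (charf B m) A"])
    show "\<alpha> \<langle>m, list_encode []\<rangle> = Some (Suc (2 * 0))" unfolding \<alpha>(2) by (simp add: P_def)
    show "H (charf B m) A \<in> T3_of_basic {H 0 A, H 1 A} 0"
      by (simp add: T3_of_basic_def charf_def)
    show "\<forall>v\<in>H (charf B m) A. wins (T3_of_basic {H 0 A, H 1 A}) \<alpha> m {charf B m} ([] @ [v])"
      by (auto intro!: wins.declare_value[where u = "charf B m"] simp: \<alpha>(2) P_def H_def)
  qed
  with \<alpha>(1) show ?thesis unfolding T3_reducible_iff_wins T3_of_T0_apply by auto
qed

lemma reducible_to_coding_iff:
  "T3_reducible (T3_of_T0 (charf B)) (T3_of_basic {H 0 A, H 1 A}) \<longleftrightarrow>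
     computable_set A \<or> computable_set B"
  using computable_if_below_coding reducible_to_computable_coding computable_reducible
  unfolding computable_set_iff[of B] by metis

section \<open>Coding degrees are not below total oracles\<close>

text \<open>
  Arthur does not see which set he has to hit, and a total oracle leaves no choice to Nimue or to
  Merlin. Hence a single play ends with a value in both sets.
\<close>

lemma wins_total_oracle_inter:
  assumes "wins (T3_of_T0 f) \<alpha> m F vs" "wins (T3_of_T0 f) \<alpha> m F' vs"
  shows "F \<inter> F' \<noteq> {}"
  using assms
proof induction
  case (declare_value vs u)
  from declare_value.prems declare_value.hyps show ?case
    by cases (auto simp: Suc_double_neq_double)
next
  case (ask vs n G)
  from ask.prems show ?case
  proof cases
    case (ask n' G')
    with \<open>\<alpha> \<langle>m, list_encode vs\<rangle> = Some (Suc (2 * n))\<close> have "n' = n" by simp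
    then have "f n \<in> G" "f n \<in> G'"
      using ask(2) \<open>G \<in> T3_of_T0 f n\<close> by (simp_all add: T3_of_T0_apply)
    then show ?thesis using ask(3) ask.IH by blast
  qed (use ask.hyps(1) in \<open>simp add: Suc_double_neq_double\<close>)
qed

lemma basic_not_reducible_to_total:
  assumes "P \<inter> Q = {}"
  shows "\<not> T3_reducible (T3_of_basic {P, Q}) (T3_of_T0 f)"
proof
  assume "T3_reducible (T3_of_basic {P, Q}) (T3_of_T0 f)"
  then obtain \<alpha> where "\<forall>m. \<forall>F\<in>{P, Q}. wins (T3_of_T0 f) \<alpha> m F []"
    unfolding T3_reducible_iff_wins T3_of_basic_def by auto
  then have "wins (T3_of_T0 f) \<alpha> 0 P []" "wins (T3_of_T0 f) \<alpha> 0 Q []" by auto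
  then have "P \<inter> Q \<noteq> {}" by (rule wins_total_oracle_inter)
  with assms show False by contradiction
qed

section \<open>Turing degrees as degrees of sets\<close>

text \<open>
  Turing degrees are introduced through functions, whereas \<open>T0_deg\<close> is defined for sets. A function
  has the same degree as its graph: one question to \<open>f\<close> decides membership in the graph, and \<open>f m\<close> is
  found by asking whether \<open>\<langle>m, 0\<rangle>\<close>, \<open>\<langle>m, 1\<rangle>\<close>, \<open>\<dots>\<close> belong to the graph until the answer is yes.
\<close>

definition graph_code :: "(nat \<Rightarrow> nat) \<Rightarrow> nat set" where
  "graph_code f = {\<langle>x, y\<rangle> | x y. f x = y}"

lemma charf_graph_code: "charf (graph_code f) \<langle>x, y\<rangle> = (if f x = y then 1 else 0)"
  by (auto simp: charf_def graph_code_def)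

lemma graph_code_reducible: "T3_reducible (T3_of_T0 (charf (graph_code f))) (T3_of_T0 f)"
proof -
  define \<alpha> where "\<alpha> x = Some (if pi2 x = 0 then Suc (2 * pi1 (pi1 x))
    else 2 * (if pi1 (pi2 x - 1) = pi2 (pi1 x) then 1 else 0))" for x
  have "partial_computable \<alpha>"
    unfolding \<alpha>_def partial_computable_Some_iff by (intro computable_intros)
  moreover have "wins (T3_of_T0 f) \<alpha> m {charf (graph_code f) m} []" for m
  proof (rule wins.ask[where n = "pi1 m" and G = "{f (pi1 m)}"])
    show "\<forall>v\<in>{f (pi1 m)}. wins (T3_of_T0 f) \<alpha> m {charf (graph_code f) m} ([] @ [v])"
      using charf_graph_code[of f "pi1 m" "pi2 m"]
      by (auto intro!: wins.declare_value[where u = "charf (graph_code f) m"] simp: \<alpha>_def)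
  qed (simp_all add: \<alpha>_def T3_of_T0_apply)
  ultimately show ?thesis unfolding T3_reducible_iff_wins T3_of_T0_apply by auto
qed

lemma reducible_graph_code: "T3_reducible (T3_of_T0 f) (T3_of_T0 (charf (graph_code f)))"
proof -
  \<comment> \<open>The only histories that occur are \<open>k\<close> negative answers, and \<open>k\<close> negative answers before a positive one.\<close>
  define zeros where "zeros k = list_encode (replicate k 0)" for k
  define zeros1 where "zeros1 k = list_encode (replicate k 0 @ [1])" for k
  have zeros_rec: "zeros k = rec_nat 0 (\<lambda>_ c. Suc \<langle>0, c\<rangle>) k" for k
    by (induction k) (simp_all add: zeros_def)
  have "computable_fun (\<lambda>k. rec_nat 0 (\<lambda>_ c. Suc \<langle>0, c\<rangle>) k)"
    by (intro computable_intros)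
  then have zeros: "computable_fun zeros" by (simp add: zeros_rec[abs_def])
  have zeros1_snoc: "zeros1 k = snoc_code (zeros k) 1" for k
    by (simp add: zeros1_def zeros_def)
  have "replicate k 0 \<noteq> replicate l 0 @ [1::nat]" for k l
    by (metis in_set_conv_decomp in_set_replicate zero_neq_one)
  then have inj: "zeros k \<noteq> zeros1 l" "zeros k = zeros l \<longleftrightarrow> k = l" "zeros1 k = zeros1 l \<longleftrightarrow> k = l" for k l
    by (auto simp: zeros_def zeros1_def inj_eq[OF inj_list_encode] dest: arg_cong[where f = length])
  define P where "P x y \<longleftrightarrow> (\<exists>m k. x = \<langle>m, zeros k\<rangle> \<and> y = Suc (2 * \<langle>m, k\<rangle>)) \<or>
    (\<exists>m k. x = \<langle>m, zeros1 k\<rangle> \<and> y = 2 * k)" for x y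
  have "semidecidable (\<lambda>w. P (pi1 w) (pi2 w))"
    unfolding P_def zeros1_snoc
    by (intro semidecidable_intros computable_intros computable_comp[OF zeros])
  then have "\<exists>\<alpha>. partial_computable \<alpha> \<and> (\<forall>x y. \<alpha> x = Some y \<longleftrightarrow> P x y)"
    by (rule partial_computable_if_single_valued)
      (unfold P_def, elim disjE exE conjE; simp add: inj inj(1)[symmetric])
  then obtain \<alpha> where \<alpha>: "partial_computable \<alpha>" "\<And>x y. \<alpha> x = Some y \<longleftrightarrow> P x y"
    by blast
  let ?g = "T3_of_T0 (charf (graph_code f))"
  have "wins ?g \<alpha> m {f m} (replicate k 0)" if "k \<le> f m" for m k
    using that
  proof (induction k rule: inc_induct)
    case base
    show ?case
    proof (rule wins.ask[where n = "\<langle>m, f m\<rangle>" and G = "{1}"])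
      show "\<alpha> \<langle>m, list_encode (replicate (f m) 0)\<rangle> = Some (Suc (2 * \<langle>m, f m\<rangle>))"
        unfolding \<alpha>(2) by (auto simp: P_def zeros_def)
      have "\<alpha> \<langle>m, list_encode (replicate (f m) 0 @ [1])\<rangle> = Some (2 * f m)"
        unfolding \<alpha>(2) by (auto simp: P_def zeros1_def)
      then show "\<forall>v\<in>{1}. wins ?g \<alpha> m {f m} (replicate (f m) 0 @ [v])"
        by (auto intro: wins.declare_value)
    qed (simp add: charf_graph_code T3_of_T0_apply)
  next
    case (step k)
    show ?case
    proof (rule wins.ask[where n = "\<langle>m, k\<rangle>" and G = "{0}"])
      show "\<alpha> \<langle>m, list_encode (replicate k 0)\<rangle> = Some (Suc (2 * \<langle>m, k\<rangle>))"
        unfolding \<alpha>(2) by (auto simp: P_def zeros_def)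
      show "\<forall>v\<in>{0}. wins ?g \<alpha> m {f m} (replicate k 0 @ [v])"
        using step.IH by (simp add: replicate_append_same)
    qed (use step.hyps in \<open>simp add: charf_graph_code T3_of_T0_apply\<close>)
  qed
  from this[of 0] have "wins ?g \<alpha> m {f m} []" for m by simp
  with \<alpha>(1) show ?thesis unfolding T3_reducible_iff_wins T3_of_T0_apply by auto
qed

lemma T0_degrees_eq: "T0_degrees = range T0_deg"
proof -
  have "T3_deg (T3_of_T0 f) = T0_deg (graph_code f)" for f
    unfolding T0_deg_def T3_deg_eq_iff by (intro conjI graph_code_reducible reducible_graph_code)
  then have "T0_degrees \<subseteq> range T0_deg"
    unfolding T0_degrees_def by auto
  moreover have "T0_deg A \<in> T0_degrees" for A
    unfolding T0_degrees_def T0_deg_def by auto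
  ultimately show ?thesis by auto
qed

lemma T0_deg_le_ctilde_iff: "T0_deg B \<le>\<^sub>T\<^sub>3 ctilde A \<longleftrightarrow> computable_set A \<or> computable_set B"
  unfolding T0_deg_def ctilde_def coding_deg_def deg_le_iff by (rule reducible_to_coding_iff)

text \<open>
  If \<open>A\<close> has degree zero then \<open>T0_deg A\<close> lies below every degree, in particular below \<open>ctilde A\<close>, and
  \<open>T0_deg_le_ctilde_iff\<close> for \<open>B = A\<close> shows that \<open>A\<close> is computable.
\<close>

lemma T0_deg_eq_zero_iff: "T0_deg A = zero_deg \<longleftrightarrow> computable_set A"
proof
  assume "T0_deg A = zero_deg"
  moreover have "zero_deg \<le>\<^sub>T\<^sub>3 ctilde A"
    unfolding zero_deg_def ctilde_def coding_deg_def deg_le_iff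
    by (intro computable_reducible computable_const)
  ultimately have "T0_deg A \<le>\<^sub>T\<^sub>3 ctilde A" by simp
  then show "computable_set A" by (simp add: T0_deg_le_ctilde_iff)
next
  assume "computable_set A"
  then have "computable_fun (charf A)" by (simp only: computable_set_iff)
  then show "T0_deg A = zero_deg"
    unfolding T0_deg_def zero_deg_def T3_deg_eq_iff
    using computable_reducible computable_reducible[OF computable_const] by simp
qed

lemma ctilde_not_le_T0_deg: "\<not> ctilde A \<le>\<^sub>T\<^sub>3 T0_deg B"
  unfolding T0_deg_def ctilde_def coding_deg_def deg_le_iff
  by (rule basic_not_reducible_to_total[OF H_disjoint])

lemma coT_eq_ctilde:
  assumes "a \<in> T0_degrees"
  shows "\<exists>A. T0_deg A = a \<and> coT a = ctilde A"
proof -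
  obtain A where "T0_deg A = a" using assms unfolding T0_degrees_eq by auto
  then have "T0_deg (SOME A. T0_deg A = a) = a" by (rule someI)
  then show ?thesis unfolding coT_def by (intro exI conjI) (assumption, rule refl)
qed

theorem theorem6p4:
  shows
    "(\<forall>A B. T0_deg B \<le>\<^sub>T\<^sub>3 ctilde A \<longleftrightarrow> computable_set A \<or> computable_set B)
   \<and> (\<forall>a \<in> T0_degrees. \<forall>b \<in> T0_degrees. b \<le>\<^sub>T\<^sub>3 coT a \<longleftrightarrow> a = zero_deg \<or> b = zero_deg)
   \<and> (\<forall>A B. \<not> ctilde A \<le>\<^sub>T\<^sub>3 T0_deg B)
   \<and> (\<forall>a \<in> T0_degrees. \<forall>b \<in> T0_degrees. \<not> coT a \<le>\<^sub>T\<^sub>3 b)"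
proof (intro conjI allI ballI)
  fix a b assume a: "a \<in> T0_degrees" and b: "b \<in> T0_degrees"
  obtain A where A: "T0_deg A = a" "coT a = ctilde A"
    using coT_eq_ctilde[OF a] by (elim exE conjE)
  obtain B where B: "T0_deg B = b" using b unfolding T0_degrees_eq by auto
  have "b \<le>\<^sub>T\<^sub>3 ctilde A \<longleftrightarrow> a = zero_deg \<or> b = zero_deg"
    unfolding A(1)[symmetric] B[symmetric] T0_deg_eq_zero_iff by (rule T0_deg_le_ctilde_iff)
  then show "b \<le>\<^sub>T\<^sub>3 coT a \<longleftrightarrow> a = zero_deg \<or> b = zero_deg"
    unfolding A(2) .
  show "\<not> coT a \<le>\<^sub>T\<^sub>3 b"
    unfolding A(2) B[symmetric] by (rule ctilde_not_le_T0_deg)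
qed (rule T0_deg_le_ctilde_iff ctilde_not_le_T0_deg)+

end
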